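(* Let $p$ be a prime, $\lambda$ a partition with at most $p-1$ parts, and $n_0:=\lceil|\lambda|/(p-1)\rceil$, $n_1:=\lambda_1$. For all $n,k\ge0$, $$\beta_\lambda^{n,k}\equiv\sum_{i=n_0}^{n_1}\beta_\lambda^{i,0}\binom{n+k-i-1}{n-i}\pmod p.$$
   Context: For a partition $\lambda=(\lambda_1\ge\lambda_2\ge\cdots>0)$, $|\lambda|$ is the sum of the parts, and $\lambda_1=0$ if $\lambda=\emptyset$; $\lambda\setminus i$ is $\lambda$ with one part $i$ removed. Binomial conventions: $\binom{i}{j}=0$ if $j<0$ or if $j>i$ with $j\ge 1$, and $\binom{i}{0}=1$ for all integers $i$ (in particular $\binom{-1}{0}=1$). $m_\lambda,e_\lambda,h_\lambda$ are the monomial, elementary and complete homogeneous symmetric functions. For $n,k\ge0$ the integers $\alpha_\lambda^{n,k}$ are defined by $$m_{(1^kp^n)}=\sum_{\lambda\vdash pn+k}\alpha_\lambda^{n,k}\,e_\lambda .$$ Consider two sets of variables $x,y$ and the ring $\mathbb{Z}[e_1,e_2,\ldots;\overline{e}_1,\overline{e}_2,\ldots]$ with $e_n:=e_n(x)$, $\overline{e}_n:=e_n(y)$, $e_0=\overline{e}_0=1$. Let $H_1^\perp$ be the Hammond operator of $H_1:=h_1(x,y)=h_1(x)+h_1(y)$ (the adjoint of multiplication by $H_1$ for the standard scalar product); explicitly it is the derivation with $H_1^\perp e_n=e_{n-1}$ and $H_1^\perp\overline{e}_n=\overline{e}_{n-1}$ for $n\ge1$. Define $$\overline{m}_{(1^kp^n)}:=\sum_{\lambda\vdash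 pn+k}\alpha_\lambda^{n,k}\,e_{\lambda\setminus\lambda_1}\,\overline{e}_{\lambda_1}\ \text{ if }k\ge n(p-2),\qquad \overline{m}_{(1^kp^n)}:=(H_1^\perp)^{n(p-2)-k}\,\overline{m}_{(1^{n(p-2)}p^n)}\ \text{ otherwise}$$ (for $n=k=0$ this is $1$). The integers $\beta_\lambda^{n,k}$ are defined by $$\overline{m}_{(1^kp^n)}=\sum_\lambda\beta_\lambda^{n,k}\,e_\lambda\,\overline{e}_{pn+k-|\lambda|},$$ with $\beta_\lambda^{n,k}=0$ if $|\lambda|>pn+k$. *)

theory Defs
  imports
    Complex_Main
    "HOL-Library.Multiset"
    "HOL-Library.Poly_Mapping"
    "HOL-Number_Theory.Cong"
    "HOL-Computational_Algebra.Primes"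
begin

section \<open>Partitions\<close>

text \<open>A partition is the multiset of its (positive) parts; its weight is \<^const>\<open>sum_mset\<close>
  and its number of parts is \<^const>\<open>size\<close>.\<close>

type_synonym partition = "nat multiset"

definition is_partition :: "partition \<Rightarrow> bool" where
  "is_partition lam \<longleftrightarrow> 0 \<notin># lam"

definition partitions_of :: "nat \<Rightarrow> partition set" where
  "partitions_of d = {lam. is_partition lam \<and> sum_mset lam = d}"

definition largest_part :: "partition \<Rightarrow> nat" where
  "largest_part lam = (if lam = {#} then 0 else Max_mset lam)"

text \<open>The partition \<open>(1\<^sup>k p\<^sup>n)\<close>.\<close>

definition one_p_partition :: "nat \<Rightarrow> nat \<Rightarrow> nat \<Rightarrow> partition" where
  "one_p_partition p n k = replicate_mset k 1 + replicate_mset n p"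

lemma finite_partitions_of: "finite (partitions_of d)"
proof -
  have "size lam \<le> sum_mset lam" if "0 \<notin># lam" for lam :: partition
    using that by (induction lam) auto
  moreover have "set_mset lam \<subseteq> {..sum_mset lam}" for lam :: partition
    by (auto dest!: multi_member_split)
  ultimately have "partitions_of d \<subseteq> mset ` {xs. set xs \<subseteq> {..d} \<and> length xs \<le> d}"
    unfolding partitions_of_def is_partition_def
    by (auto simp: image_iff) (metis ex_mset mem_Collect_eq set_mset_mset size_mset)
  then show ?thesis
    by (rule finite_subset) (simp add: finite_lists_length_le)
qed

lemma finite_partitions_upto: "finite {lam. is_partition lam \<and> sum_mset lam \<le> d}"
proof -
  have "{lam. is_partition lam \<and> sum_mset lam \<le> d} = (\<Union>c\<le>d. partitions_of c)"
    by (auto simp: partitions_of_def)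
  then show ?thesis
    by (simp add: finite_partitions_of)
qed


section \<open>Symmetric functions\<close>

text \<open>Polynomials over the integers in the variables \<open>x\<^sub>0, x\<^sub>1, \<dots>\<close>.  A symmetric function \<open>f\<close>
  is given by the compatible family of the symmetric polynomials
  \<open>f(x\<^sub>0, \<dots>, x\<^bsub>N-1\<^esub>)\<close> for \<open>N = 0, 1, 2, \<dots>\<close> (the ring of symmetric functions being the graded
  inverse limit of the rings of symmetric polynomials), so an identity between symmetric
  functions is an identity of polynomials for every number \<open>N\<close> of variables.\<close>

type_synonym xpoly = "(nat \<Rightarrow>\<^sub>0 nat) \<Rightarrow>\<^sub>0 int"

definition monomials_of_type :: "nat \<Rightarrow> partition \<Rightarrow> (nat \<Rightarrow>\<^sub>0 nat) set" where
  "monomials_of_type N lam =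
     {v. Poly_Mapping.keys v \<subseteq> {..<N} \<and>
         image_mset (Poly_Mapping.lookup v) (mset_set (Poly_Mapping.keys v)) = lam}"

definition sym_m :: "nat \<Rightarrow> partition \<Rightarrow> xpoly" where
  "sym_m N lam = (\<Sum>v\<in>monomials_of_type N lam. Poly_Mapping.single v 1)"

definition sym_e :: "nat \<Rightarrow> nat \<Rightarrow> xpoly" where
  "sym_e N r = (\<Sum>S | S \<subseteq> {..<N} \<and> card S = r.
     \<Prod>i\<in>S. Poly_Mapping.single (Poly_Mapping.single i 1) 1)"

definition sym_e_part :: "nat \<Rightarrow> partition \<Rightarrow> xpoly" where
  "sym_e_part N lam = (\<Prod>r\<in>#lam. sym_e N r)"

lemma finite_monomials_of_type: "finite (monomials_of_type N lam)"
proof -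
  let ?F = "{f :: nat \<Rightarrow> nat. \<forall>i. (i \<in> {..<N} \<longrightarrow> f i \<in> insert 0 (set_mset lam)) \<and>
                               (i \<notin> {..<N} \<longrightarrow> f i = 0)}"
  have "finite ?F"
    by (rule finite_set_of_finite_funs) auto
  moreover have "Poly_Mapping.lookup ` monomials_of_type N lam \<subseteq> ?F"
    unfolding monomials_of_type_def
    by (auto simp: image_iff) (metis in_keys_iff, metis in_keys_iff lessThan_iff subsetD)
  ultimately have "finite (Poly_Mapping.lookup ` monomials_of_type N lam)"
    by (rule finite_subset[rotated])
  then show ?thesis
    by (rule finite_imageD) (auto simp: inj_on_def lookup_inject)
qed

text \<open>The coefficients in
  \<open>m\<^bsub>(1\<^sup>k p\<^sup>n)\<^esub> = \<Sum>\<^bsub>\<lambda> \<turnstile> pn+k\<^esub> \<alpha>\<^bsub>\<lambda>\<^esub> e\<^bsub>\<lambda>\<^esub>\<close>,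
  extended by 0 to multisets that are not partitions of \<open>pn+k\<close>; they exist and are unique by the
  fundamental theorem of symmetric functions.\<close>

definition alpha :: "nat \<Rightarrow> nat \<Rightarrow> nat \<Rightarrow> partition \<Rightarrow> int" where
  "alpha p n k = (THE a.
     (\<forall>lam. lam \<notin> partitions_of (p * n + k) \<longrightarrow> a lam = 0) \<and>
     (\<forall>N. sym_m N (one_p_partition p n k) =
        (\<Sum>lam\<in>partitions_of (p * n + k). of_int (a lam) * sym_e_part N lam)))"


section \<open>The polynomial ring in the elementary symmetric functions of two alphabets\<close>

text \<open>The \<open>e\<^sub>n(x)\<close> and \<open>e\<^sub>n(y)\<close> with \<open>n \<ge> 1\<close> are algebraically independent, so they are
  the indeterminates of a polynomial ring.  To have no spurious indeterminates, \<open>Inl i\<close> stands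
  for \<open>e\<^bsub>i+1\<^esub>(x)\<close> and \<open>Inr i\<close> for \<open>e\<^bsub>i+1\<^esub>(y)\<close>.\<close>

type_synonym epoly = "((nat + nat) \<Rightarrow>\<^sub>0 nat) \<Rightarrow>\<^sub>0 int"

definition ex :: "nat \<Rightarrow> epoly" where
  "ex n = (case n of 0 \<Rightarrow> 1
     | Suc i \<Rightarrow> Poly_Mapping.single (Poly_Mapping.single (Inl i) 1) 1)"

definition ey :: "nat \<Rightarrow> epoly" where
  "ey n = (case n of 0 \<Rightarrow> 1
     | Suc i \<Rightarrow> Poly_Mapping.single (Poly_Mapping.single (Inr i) 1) 1)"

definition ex_part :: "partition \<Rightarrow> epoly" where
  "ex_part lam = (\<Prod>r\<in>#lam. ex r)"

definition derivation :: "('a::comm_ring_1 \<Rightarrow> 'a) \<Rightarrow> bool" where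
  "derivation D \<longleftrightarrow>
     (\<forall>f g. D (f + g) = D f + D g) \<and> (\<forall>f g. D (f * g) = D f * g + f * D g)"

text \<open>The Hammond operator of \<open>H\<^sub>1 = h\<^sub>1(x) + h\<^sub>1(y)\<close>, i.e. the adjoint of multiplication
  by \<open>H\<^sub>1\<close>, is the derivation lowering the index of every generator by 1.  Existence and
  uniqueness: \<open>H1_perp_props\<close> below.\<close>

definition H1_perp :: "epoly \<Rightarrow> epoly" where
  "H1_perp = (THE D. derivation D \<and>
     (\<forall>n\<ge>1. D (ex n) = ex (n - 1)) \<and> (\<forall>n\<ge>1. D (ey n) = ey (n - 1)))"

definition mbar_raw :: "nat \<Rightarrow> nat \<Rightarrow> nat \<Rightarrow> epoly" where
  "mbar_raw p n k = (\<Sum>lam\<in>partitions_of (p * n + k).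
     of_int (alpha p n k lam) * ex_part (lam - {#largest_part lam#}) * ey (largest_part lam))"

definition mbar :: "nat \<Rightarrow> nat \<Rightarrow> nat \<Rightarrow> epoly" where
  "mbar p n k =
     (if k \<ge> n * (p - 2) then mbar_raw p n k
      else (H1_perp ^^ (n * (p - 2) - k)) (mbar_raw p n (n * (p - 2))))"

text \<open>The \<open>e\<^bsub>\<lambda>\<^esub>(x) e\<^bsub>d-|\<lambda>|\<^esub>(y)\<close> with \<open>|\<lambda>| \<le> d\<close> are distinct
  monomials, and \<^const>\<open>mbar\<close> is an integer combination of them for \<open>d = pn+k\<close>, so the
  coefficients exist and are unique.\<close>

definition beta :: "nat \<Rightarrow> nat \<Rightarrow> nat \<Rightarrow> partition \<Rightarrow> int" where
  "beta p n k = (THE b.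
     (\<forall>lam. \<not> (is_partition lam \<and> sum_mset lam \<le> p * n + k) \<longrightarrow> b lam = 0) \<and>
     mbar p n k = (\<Sum>lam | is_partition lam \<and> sum_mset lam \<le> p * n + k.
        of_int (b lam) * ex_part lam * ey (p * n + k - sum_mset lam)))"


section \<open>Binomial coefficients\<close>

text \<open>Differs from the generalised binomial coefficient at negative upper arguments.\<close>

definition binom :: "int \<Rightarrow> int \<Rightarrow> int" where
  "binom i j =
     (if j < 0 then 0 else if j = 0 then 1 else if j > i then 0
      else int (nat i choose nat j))"


section \<open>Well-definedness of the Hammond operator\<close>

text \<open>The sum of the \<open>e\<^bsub>n-1\<^esub> \<partial>/\<partial>e\<^sub>n\<close>, on a monomial.\<close>

definition H1_gen :: "nat + nat \<Rightarrow> epoly" where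
  "H1_gen v = (case v of Inl i \<Rightarrow> ex i | Inr i \<Rightarrow> ey i)"

definition H1_mono :: "((nat + nat) \<Rightarrow>\<^sub>0 nat) \<Rightarrow> epoly" where
  "H1_mono m = (\<Sum>v\<in>Poly_Mapping.keys m. of_nat (Poly_Mapping.lookup m v) *
     Poly_Mapping.single (m - Poly_Mapping.single v 1) 1 * H1_gen v)"

lemma H1_mono_superset:
  assumes "finite A" "Poly_Mapping.keys m \<subseteq> A"
  shows "H1_mono m = (\<Sum>v\<in>A. of_nat (Poly_Mapping.lookup m v) *
     Poly_Mapping.single (m - Poly_Mapping.single v 1) 1 * H1_gen v)"
  unfolding H1_mono_def
  by (rule sum.mono_neutral_left) (use assms in \<open>auto simp: in_keys_iff\<close>)

lemma H1_mono_add: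
  "H1_mono (m + m') =
     H1_mono m * Poly_Mapping.single m' 1 + Poly_Mapping.single m 1 * H1_mono m'"
proof -
  let ?s = "\<lambda>v :: nat + nat. Poly_Mapping.single v (1::nat)"
  let ?A = "Poly_Mapping.keys m \<union> Poly_Mapping.keys m'"
  have shift: "of_nat (Poly_Mapping.lookup a v) * Poly_Mapping.single (a + b - ?s v) (1::int) =
      of_nat (Poly_Mapping.lookup a v) * Poly_Mapping.single (a - ?s v) 1 * Poly_Mapping.single b 1"
    for a b :: "(nat + nat) \<Rightarrow>\<^sub>0 nat" and v
  proof (cases "Poly_Mapping.lookup a v = 0")
    case False
    then have "a + b - ?s v = (a - ?s v) + b"
      by (intro poly_mapping_eqI) (auto simp: lookup_add lookup_minus lookup_single when_def)
    then show ?thesis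
      by (simp add: mult.assoc mult_single)
  qed simp
  have "H1_mono (m + m') = (\<Sum>v\<in>?A. of_nat (Poly_Mapping.lookup (m + m') v) *
      Poly_Mapping.single (m + m' - ?s v) 1 * H1_gen v)"
    by (rule H1_mono_superset) (auto simp: in_keys_iff lookup_add)
  also have "\<dots> = (\<Sum>v\<in>?A.
      of_nat (Poly_Mapping.lookup m v) * Poly_Mapping.single (m - ?s v) 1 * H1_gen v
        * Poly_Mapping.single m' 1
      + Poly_Mapping.single m 1 *
        (of_nat (Poly_Mapping.lookup m' v) * Poly_Mapping.single (m' - ?s v) 1 * H1_gen v))"
  proof (rule sum.cong[OF refl])
    fix v
    show "of_nat (Poly_Mapping.lookup (m + m') v) * Poly_Mapping.single (m + m' - ?s v) 1 * H1_gen v =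
      of_nat (Poly_Mapping.lookup m v) * Poly_Mapping.single (m - ?s v) 1 * H1_gen v
        * Poly_Mapping.single m' 1
      + Poly_Mapping.single m 1 *
        (of_nat (Poly_Mapping.lookup m' v) * Poly_Mapping.single (m' - ?s v) 1 * H1_gen v)"
      using shift[of m v m'] shift[of m' v m]
      by (simp add: lookup_add add.commute[of m' m] distrib_left distrib_right mult_ac)
  qed
  also have "\<dots> = H1_mono m * Poly_Mapping.single m' 1 + Poly_Mapping.single m 1 * H1_mono m'"
    using H1_mono_superset[of ?A m] H1_mono_superset[of ?A m']
    by (simp add: sum.distrib sum_distrib_left sum_distrib_right)
  finally show ?thesis .
qed

lemma epoly_induct [case_names zero diff mono]:
  fixes f :: epoly
  assumes "P 0" "\<And>f g. P f \<Longrightarrow> P g \<Longrightarrow> P (f - g)" "\<And>m. P (Poly_Mapping.single m 1)"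
  shows "P f"
  by (rule frag_induction[of f UNIV]) (use assms in auto)

lemma derivation_H1: "derivation (frag_extend H1_mono)"
proof -
  let ?D = "frag_extend H1_mono :: epoly \<Rightarrow> epoly"
  have "?D (f * g) = ?D f * g + f * ?D g" for f g
  proof (induction f rule: epoly_induct)
    case (diff f f')
    then show ?case by (simp add: frag_extend_diff algebra_simps)
  next
    case (mono m)
    show ?case
    proof (induction g rule: epoly_induct)
      case (diff g g')
      then show ?case by (simp add: frag_extend_diff algebra_simps)
    next
      case (mono m')
      then show ?case by (simp add: mult_single H1_mono_add)
    qed simp
  qed simp
  then show ?thesis
    unfolding derivation_def by (simp add: frag_extend_add)
qed

lemma derivation_unique:
  fixes D D' :: "epoly \<Rightarrow> epoly"
  assumes D: "derivation D" and D': "derivation D'"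
    and gen: "\<And>v. D (Poly_Mapping.single (Poly_Mapping.single v 1) 1) =
                   D' (Poly_Mapping.single (Poly_Mapping.single v 1) 1)"
  shows "D = D'"
proof
  have add: "D (f + g) = D f + D g" "D' (f + g) = D' f + D' g"
    and mult: "D (f * g) = D f * g + f * D g" "D' (f * g) = D' f * g + f * D' g" for f g
    using D D' by (auto simp: derivation_def)
  have diff: "D (f - g) = D f - D g" "D' (f - g) = D' f - D' g" for f g
    using add[of "f - g" g] by (simp_all add: algebra_simps)
  have zero: "D 0 = 0" "D' 0 = 0"
    using diff[of 0 0] by auto
  have one: "D 1 = 0" "D' 1 = 0"
    using mult[of 1 1] by auto
  have step: "D (Poly_Mapping.single (Poly_Mapping.single v n) 1) =
      D' (Poly_Mapping.single (Poly_Mapping.single v n) 1)" for v n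
  proof (induction n)
    case (Suc n)
    have "Poly_Mapping.single (Poly_Mapping.single v (Suc n)) (1::int) =
      Poly_Mapping.single (Poly_Mapping.single v 1) 1 *
      Poly_Mapping.single (Poly_Mapping.single v n) 1"
      by (simp add: mult_single flip: single_add)
    then show ?case
      using Suc gen[of v] by (simp only: mult)
  qed (simp add: one)
  fix f
  show "D f = D' f"
  proof (induction f rule: epoly_induct)
    case (mono m)
    show ?case
    proof (induction m rule: update_induct)
      case const
      then show ?case by (simp add: one)
    next
      case (update m v n)
      have "Poly_Mapping.update v n m = Poly_Mapping.single v n + m"
        using update by (intro poly_mapping_eqI)
          (auto simp: lookup_update lookup_add lookup_single when_def in_keys_iff)
      then have "Poly_Mapping.single (Poly_Mapping.update v n m) (1::int) =
        Poly_Mapping.single (Poly_Mapping.single v n) 1 * Poly_Mapping.single m 1"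
        by (simp add: mult_single)
      then show ?case
        using update step[of v n] by (simp only: mult)
    qed
  qed (simp_all add: zero diff)
qed

theorem H1_perp_props:
  "derivation H1_perp"
  "n \<ge> 1 \<Longrightarrow> H1_perp (ex n) = ex (n - 1)"
  "n \<ge> 1 \<Longrightarrow> H1_perp (ey n) = ey (n - 1)"
proof -
  let ?P = "\<lambda>D. derivation D \<and>
     (\<forall>n\<ge>1. D (ex n) = ex (n - 1)) \<and> (\<forall>n\<ge>1. D (ey n) = ey (n - 1))"
  have "?P (frag_extend H1_mono)"
    using derivation_H1
    by (auto simp: ex_def[of "Suc _"] ey_def[of "Suc _"] H1_mono_def H1_gen_def
        dest!: Suc_le_D)
  then have "\<exists>D. ?P D" by (intro exI[of _ "frag_extend H1_mono"])
  moreover have "D = D'" if "?P D" "?P D'" for D D'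
  proof (rule derivation_unique)
    fix v :: "nat + nat"
    show "D (Poly_Mapping.single (Poly_Mapping.single v 1) 1) =
          D' (Poly_Mapping.single (Poly_Mapping.single v 1) 1)"
    proof (cases v)
      case (Inl i)
      then have "Poly_Mapping.single (Poly_Mapping.single v 1) 1 = ex (Suc i)"
        by (simp add: ex_def)
      then show ?thesis using that by simp
    next
      case (Inr i)
      then have "Poly_Mapping.single (Poly_Mapping.single v 1) 1 = ey (Suc i)"
        by (simp add: ey_def)
      then show ?thesis using that by simp
    qed
  qed (use that in auto)
  ultimately have "?P H1_perp"
    unfolding H1_perp_def by (intro theI'[of ?P] ex_ex1I)
  then show "derivation H1_perp"
    "n \<ge> 1 \<Longrightarrow> H1_perp (ex n) = ex (n - 1)"
    "n \<ge> 1 \<Longrightarrow> H1_perp (ey n) = ey (n - 1)"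
    by auto
qed

end

(* In Z[t][x] one has the identity
     prod_j (1 + x_j) * prod_j (1 + t * sum_{0<r<p} (-x_j)^r)
       = prod_j (1 + (1 - t) x_j - (-1)^p t x_j^p).
   Multiply it by (1 - t)^(-k) and take the coefficient of t^n in degree d = pn + k.  On the right,
   m_(1^(k+pl) p^(n-l)) occurs with coefficient (up to sign) binom(pl, l), divisible by p for l > 0.
   Hence, modulo p,
     m_(1^k p^n) = sum_lambda h_lambda e_lambda e_(d-|lambda|),
     h_lambda = sum_i gamma_(i,lambda) binom(n+k-i-1, n-i),
   where gamma_(i,lambda) is the coefficient of t^i e_lambda in the second product on the left.
   It vanishes unless |lambda| <= (p-1) i and i <= lambda_1.  If k >= n(p-2), then d - |lambda| is
   the largest part of every partition that occurs, so mbar_(1^k p^n) is congruent to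
   sum_lambda h_lambda e_lambda(x) e_(d-|lambda|)(y).  Applying H_1^perp to such a sum lowers k by 1,
   by Pascal's rule and because taking the coefficient of x_j^1 multiplies the second product
   by -t; so the congruence holds for all k.  Thus beta_lambda^(n,k) is congruent to h_lambda, and
   k = 0 gives gamma_(i,lambda) = beta_lambda^(i,0) modulo p. *)
theory Submission
  imports
    Defs
    "HOL-Computational_Algebra.Formal_Power_Series"
    "HOL-Combinatorics.Permutations"
begin

section \<open>Operators on polynomials\<close>

text \<open>\<open>alpha\<close> and \<open>beta\<close> are given by \<open>THE\<close>, so
  existence and uniqueness have to be proved along the way. One statement serves all comparisons of
  coefficients: in N variables, the products e_lambda with parts at most N are independent modulo
  every integer q. The case q = 0 gives uniqueness; q = p turns a congruence of polynomials into one
  of coefficients. The freedom in the number of variables also yields the upper limit of the sum: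
  m_mu vanishes in fewer variables than mu has parts, so e_lambda can occur in it only if lambda_1
  is at least that number of parts. The generating function lives among polynomials in the x_j,
  whereas \<open>H1_perp\<close> acts on formal generators. The bridge is \<open>m_ex\<close>, which
  is m_mu rewritten in the e_n(x): there \<open>H1_perp\<close> becomes the coefficient of x_N to
  the first power in N + 1 variables, and on m_mu this just deletes a part 1. For this reason the
  sums over lambda are regrouped as sums over mu before \<open>H1_perp\<close> is applied.\<close>

lemma frag_induct [case_names zero diff of]:
  fixes f :: "'a \<Rightarrow>\<^sub>0 int"
  assumes "P 0" "\<And>f g. P f \<Longrightarrow> P g \<Longrightarrow> P (f - g)" "\<And>m. P (frag_of m)"
  shows "P f"
  by (rule frag_induction[of f UNIV]) (use assms in auto)

lemma frag_extend_sum': "frag_extend b (\<Sum>i\<in>I. g i) = (\<Sum>i\<in>I. frag_extend b (g i))"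
  by (cases "finite I") (simp_all add: frag_extend_sum comp_def)

lemma frag_of_mult: "frag_of (m + m') = frag_of m * frag_of m'"
  by (simp add: mult_single)

text \<open>Integer polynomials form the free abelian group on their exponent vectors, and
  \<open>frag_extend\<close> is linear extension from that basis. Multiplying monomials adds
  exponents, so substitutions and permutations of variables become multiplicative through this
  lemma.\<close>

lemma frag_extend_mult:
  fixes b :: "'a::comm_monoid_add \<Rightarrow> 'b::comm_monoid_add \<Rightarrow>\<^sub>0 int"
  assumes "\<And>m m'. b (m + m') = b m * b m'"
  shows "frag_extend b (f * g) = frag_extend b f * frag_extend b g"
proof (induction f rule: frag_induct)
  case (diff f f')
  then show ?case by (simp add: frag_extend_diff algebra_simps)
next
  case (of m)
  show ?case
  proof (induction g rule: frag_induct)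
    case (diff g g')
    then show ?case by (simp add: frag_extend_diff algebra_simps)
  next
    case (of m')
    then show ?case using assms by (simp flip: frag_of_mult)
  qed simp
qed simp

lemma frag_cmul_conv: "frag_cmul c (f :: 'a::comm_monoid_add \<Rightarrow>\<^sub>0 int) = of_int c * f"
proof -
  have "frag_cmul (int n) f = of_nat n * f" for n
    by (induction n) (simp_all add: frag_cmul_distrib algebra_simps)
  note nat = this
  show ?thesis
  proof (cases c rule: int_cases2)
    case (nonneg n)
    then show ?thesis by (simp add: nat)
  next
    case (nonpos n)
    then have "frag_cmul c f = - frag_cmul (int n) f" by simp
    also have "\<dots> = of_int c * f" unfolding nat nonpos by simp
    finally show ?thesis .
  qed
qed

lemma frag_extend_of_int_mult:
  fixes b :: "'a::comm_monoid_add \<Rightarrow> 'b::comm_monoid_add \<Rightarrow>\<^sub>0 int"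
  shows "frag_extend b (of_int c * f) = of_int c * frag_extend b f"
  by (simp add: frag_extend_cmul flip: frag_cmul_conv)

lemma lookup_of_int_mult:
  fixes f :: "'a::comm_monoid_add \<Rightarrow>\<^sub>0 int"
  shows "Poly_Mapping.lookup (of_int c * f) m = c * Poly_Mapping.lookup f m"
  by (simp flip: frag_cmul_conv)

text \<open>Congruences between polynomials are written throughout as divisibility by a constant;
  this is the passage to coefficients.\<close>

lemma of_int_dvd_iff_lookup:
  fixes f :: "'a::comm_monoid_add \<Rightarrow>\<^sub>0 int"
  shows "of_int q dvd f \<longleftrightarrow> (\<forall>m. q dvd Poly_Mapping.lookup f m)"
proof
  assume "of_int q dvd f"
  then show "\<forall>m. q dvd Poly_Mapping.lookup f m"
    by (auto simp: lookup_of_int_mult elim!: dvdE)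
next
  assume q: "\<forall>m. q dvd Poly_Mapping.lookup f m"
  have "of_int q dvd frag_cmul (Poly_Mapping.lookup f m) (frag_of m)" for m
    unfolding frag_cmul_conv using q by (metis dvd_def dvd_mult2 of_int_mult)
  then show "of_int q dvd f"
    by (subst frag_expansion) (auto simp: frag_extend_def intro!: dvd_sum)
qed

lemma lookup_frag_of_mult:
  fixes f :: "'a::cancel_comm_monoid_add \<Rightarrow>\<^sub>0 int"
  shows "Poly_Mapping.lookup (frag_of m * f) (m + v) = Poly_Mapping.lookup f v"
proof (induction f rule: frag_induct)
  case (diff f g)
  then show ?case by (simp add: right_diff_distrib lookup_minus)
next
  case (of w)
  then show ?case by (simp add: lookup_single when_def flip: frag_of_mult)
qed simp

text \<open>Multiplication by a monomial only shifts exponents, so it stays injective modulo every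
  \<open>q\<close>. This is what permits cancelling e_N in N variables, which is a single
  monomial.\<close>

lemma of_int_dvd_frag_of_mult:
  fixes f :: "'a::cancel_comm_monoid_add \<Rightarrow>\<^sub>0 int"
  assumes "of_int q dvd frag_of m * f"
  shows "of_int q dvd f"
  using assms unfolding of_int_dvd_iff_lookup by (metis lookup_frag_of_mult)

section \<open>Setting a variable to zero and extracting its first power\<close>

definition xvar :: "nat \<Rightarrow> xpoly" where
  "xvar i = frag_of (Poly_Mapping.single i 1)"

definition set_var_zero :: "nat \<Rightarrow> xpoly \<Rightarrow> xpoly" where
  "set_var_zero N = frag_extend (\<lambda>m. if Poly_Mapping.lookup m N = 0 then frag_of m else 0)"

text \<open>The derivative in x_N, taken at x_N = 0. On symmetric functions this is the adjoint of
  multiplication by h_1, hence the polynomial model of \<open>H1_perp\<close>.\<close>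

definition linear_coeff :: "nat \<Rightarrow> xpoly \<Rightarrow> xpoly" where
  "linear_coeff N = frag_extend (\<lambda>m. if Poly_Mapping.lookup m N = 1
     then frag_of (m - Poly_Mapping.single N 1) else 0)"

lemma set_var_zero_mult: "set_var_zero N (f * g) = set_var_zero N f * set_var_zero N g"
  unfolding set_var_zero_def by (rule frag_extend_mult) (simp add: lookup_add frag_of_mult)

lemma set_var_zero_one [simp]: "set_var_zero N 1 = 1"
  unfolding set_var_zero_def single_one[symmetric] frag_extend_of by simp

lemma set_var_zero_zero [simp]: "set_var_zero N 0 = 0"
  unfolding set_var_zero_def by simp

lemma set_var_zero_add: "set_var_zero N (f + g) = set_var_zero N f + set_var_zero N g"
  unfolding set_var_zero_def by (rule frag_extend_add)

lemma set_var_zero_diff: "set_var_zero N (f - g) = set_var_zero N f - set_var_zero N g"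
  unfolding set_var_zero_def by (rule frag_extend_diff)

lemma set_var_zero_sum: "set_var_zero N (\<Sum>i\<in>I. g i) = (\<Sum>i\<in>I. set_var_zero N (g i))"
  unfolding set_var_zero_def by (rule frag_extend_sum')

lemma set_var_zero_of_int_mult: "set_var_zero N (of_int c * f) = of_int c * set_var_zero N f"
  unfolding set_var_zero_def by (rule frag_extend_of_int_mult)

lemma set_var_zero_xvar: "set_var_zero N (xvar i) = (if i = N then 0 else xvar i)"
  unfolding set_var_zero_def xvar_def by (simp add: lookup_single when_def)

lemma lookup_set_var_zero:
  "Poly_Mapping.lookup (set_var_zero N f) v =
     (if Poly_Mapping.lookup v N = 0 then Poly_Mapping.lookup f v else 0)"
proof (induction f rule: frag_induct)
  case (diff f g)
  then show ?case by (simp add: set_var_zero_diff lookup_minus)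
next
  case (of m)
  then show ?case by (auto simp: set_var_zero_def lookup_single when_def)
qed simp

lemma linear_coeff_zero [simp]: "linear_coeff N 0 = 0"
  unfolding linear_coeff_def by simp

lemma linear_coeff_add: "linear_coeff N (f + g) = linear_coeff N f + linear_coeff N g"
  unfolding linear_coeff_def by (rule frag_extend_add)

lemma linear_coeff_diff: "linear_coeff N (f - g) = linear_coeff N f - linear_coeff N g"
  unfolding linear_coeff_def by (rule frag_extend_diff)

lemma linear_coeff_sum: "linear_coeff N (\<Sum>i\<in>I. g i) = (\<Sum>i\<in>I. linear_coeff N (g i))"
  unfolding linear_coeff_def by (rule frag_extend_sum')

lemma linear_coeff_of_int_mult: "linear_coeff N (of_int c * f) = of_int c * linear_coeff N f"
  unfolding linear_coeff_def by (rule frag_extend_of_int_mult)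

text \<open>Up to multiples of x_N^2, \<open>f\<close> is
  \<open>set_var_zero N f + xvar N * linear_coeff N f\<close>; multiply two such expansions.\<close>

lemma linear_coeff_mult:
  "linear_coeff N (f * g) = linear_coeff N f * set_var_zero N g + set_var_zero N f * linear_coeff N g"
proof (induction f rule: frag_induct)
  case (diff f f')
  then show ?case by (simp add: linear_coeff_diff set_var_zero_diff algebra_simps)
next
  case (of m)
  show ?case
  proof (induction g rule: frag_induct)
    case (diff g g')
    then show ?case by (simp add: linear_coeff_diff set_var_zero_diff algebra_simps)
  next
    case (of m')
    have 1: "m + m' - Poly_Mapping.single N 1 = (m - Poly_Mapping.single N 1) + m'"
      if "Poly_Mapping.lookup m N = 1"
      using that by (intro poly_mapping_eqI)
        (auto simp: lookup_add lookup_minus lookup_single when_def)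
    have 2: "m + m' - Poly_Mapping.single N 1 = m + (m' - Poly_Mapping.single N 1)"
      if "Poly_Mapping.lookup m' N = 1"
      using that by (intro poly_mapping_eqI)
        (auto simp: lookup_add lookup_minus lookup_single when_def)
    have "linear_coeff N (frag_of (m + m')) =
      linear_coeff N (frag_of m) * set_var_zero N (frag_of m') +
      set_var_zero N (frag_of m) * linear_coeff N (frag_of m')"
      unfolding linear_coeff_def set_var_zero_def frag_extend_of
      using 1 2 by (auto simp: lookup_add frag_of_mult add_is_1)
    then show ?case by (simp add: frag_of_mult)
  qed simp
qed simp

lemma linear_coeff_one [simp]: "linear_coeff N 1 = 0"
  unfolding linear_coeff_def single_one[symmetric] frag_extend_of by simp

lemma linear_coeff_xvar: "linear_coeff N (xvar i) = (if i = N then 1 else 0)"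
  unfolding linear_coeff_def xvar_def by (simp add: lookup_single when_def)

section \<open>Elementary symmetric polynomials\<close>

lemma sym_e_alt: "sym_e N r = (\<Sum>S | S \<subseteq> {..<N} \<and> card S = r. \<Prod>i\<in>S. xvar i)"
  by (simp add: sym_e_def xvar_def)

lemma sym_e_0 [simp]: "sym_e N 0 = 1"
proof -
  have "{S. S \<subseteq> {..<N} \<and> card S = 0} = {{}}"
    by (auto dest: finite_subset)
  then show ?thesis by (simp add: sym_e_alt)
qed

lemma sym_e_eq_0: "r > N \<Longrightarrow> sym_e N r = 0"
proof -
  assume "r > N"
  then have "{S. S \<subseteq> {..<N} \<and> card S = r} = {}"
    using card_mono[of "{..<N}"] by (auto simp: not_less[symmetric])
  then show ?thesis unfolding sym_e_alt by (metis sum.empty)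
qed

lemma sym_e_Suc_Suc: "sym_e (Suc N) (Suc r) = sym_e N (Suc r) + xvar N * sym_e N r"
proof -
  let ?A = "\<lambda>N r. {S. S \<subseteq> {..<N} \<and> card S = r}"
  have fin: "finite (?A N r)" for N r :: nat
    by (rule finite_subset[of _ "Pow {..<N}"]) auto
  have inj: "inj_on (insert N) (?A N r)"
    unfolding inj_on_def by (metis (mono_tags) Diff_insert_absorb lessThan_iff less_irrefl
        mem_Collect_eq subsetD)
  have card_ins: "card (insert N S) = Suc (card S)" if "S \<subseteq> {..<N}" for S
    using that by (subst card_insert_disjoint) (auto intro: finite_subset)
  have eq: "?A (Suc N) (Suc r) = ?A N (Suc r) \<union> insert N ` ?A N r" (is "?L = ?R")
  proof
    show "?R \<subseteq> ?L" using card_ins by auto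
    show "?L \<subseteq> ?R"
    proof
      fix S assume S: "S \<in> ?L"
      then have f: "finite S" by (auto intro: finite_subset)
      show "S \<in> ?R"
      proof (cases "N \<in> S")
        case True
        then have "S = insert N (S - {N})" "S - {N} \<in> ?A N r"
          using S f by (auto simp: less_Suc_eq card_Diff_singleton)
        then show ?thesis by blast
      next
        case False
        then show ?thesis using S by (auto simp: less_Suc_eq)
      qed
    qed
  qed
  have "?A N (Suc r) \<inter> insert N ` ?A N r = {}" by auto
  then have "sym_e (Suc N) (Suc r) = sym_e N (Suc r) + (\<Sum>S\<in>insert N ` ?A N r. \<Prod>i\<in>S. xvar i)"
    unfolding sym_e_alt eq using fin by (intro sum.union_disjoint) auto
  also have "(\<Sum>S\<in>insert N ` ?A N r. \<Prod>i\<in>S. xvar i) = (\<Sum>S\<in>?A N r. xvar N * (\<Prod>i\<in>S. xvar i))"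
    by (subst sum.reindex[OF inj]) (auto intro!: sum.cong prod.insert intro: finite_subset)
  finally show ?thesis by (simp add: sym_e_alt sum_distrib_left)
qed

lemma sym_e_0_Suc: "sym_e 0 (Suc r) = 0"
  by (simp add: sym_e_eq_0)

lemma set_var_zero_sym_e_le: "N' \<le> N \<Longrightarrow> set_var_zero N (sym_e N' r) = sym_e N' r"
proof (induction N' arbitrary: r)
  case 0
  then show ?case by (cases r) (simp_all add: sym_e_0_Suc)
next
  case (Suc N')
  then show ?case
    by (cases r) (simp_all add: sym_e_Suc_Suc set_var_zero_add set_var_zero_mult set_var_zero_xvar)
qed

lemma set_var_zero_sym_e: "set_var_zero N (sym_e (Suc N) r) = sym_e N r"
  by (cases r)
    (simp_all add: sym_e_Suc_Suc set_var_zero_add set_var_zero_mult set_var_zero_xvar set_var_zero_sym_e_le)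

lemma linear_coeff_sym_e_le: "N' \<le> N \<Longrightarrow> linear_coeff N (sym_e N' r) = 0"
proof (induction N' arbitrary: r)
  case 0
  then show ?case by (cases r) (simp_all add: sym_e_0_Suc)
next
  case (Suc N')
  then show ?case
    by (cases r) (simp_all add: sym_e_Suc_Suc linear_coeff_add linear_coeff_mult linear_coeff_xvar)
qed

text \<open>Counterpart of the rule by which \<open>H1_perp\<close> lowers the index of a generator,
  at the price of one variable.\<close>

lemma linear_coeff_sym_e: "linear_coeff N (sym_e (Suc N) (Suc r)) = sym_e N r"
  by (simp add: sym_e_Suc_Suc linear_coeff_add linear_coeff_mult linear_coeff_xvar
      linear_coeff_sym_e_le set_var_zero_xvar set_var_zero_sym_e_le)

lemma sym_e_part_empty [simp]: "sym_e_part N {#} = 1"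
  by (simp add: sym_e_part_def)

lemma sym_e_part_add_mset [simp]: "sym_e_part N (add_mset r lam) = sym_e N r * sym_e_part N lam"
  by (simp add: sym_e_part_def)

lemma set_var_zero_sym_e_part: "set_var_zero N (sym_e_part (Suc N) lam) = sym_e_part N lam"
  by (induction lam) (simp_all add: set_var_zero_mult set_var_zero_sym_e)

lemma sym_e_part_eq_0: "r \<in># lam \<Longrightarrow> r > N \<Longrightarrow> sym_e_part N lam = 0"
  by (auto dest!: multi_member_split simp: sym_e_eq_0)

definition all_vars :: "nat \<Rightarrow> nat \<Rightarrow>\<^sub>0 nat" where
  "all_vars N = (\<Sum>i<N. Poly_Mapping.single i 1)"

lemma sym_e_self: "sym_e N N = frag_of (all_vars N)"
  unfolding all_vars_def
  by (induction N)
    (simp_all add: sym_e_Suc_Suc sym_e_eq_0 xvar_def frag_of_mult mult.commute)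

section \<open>Monomial symmetric polynomials\<close>

lemma monomials_of_type_0: "monomials_of_type 0 mu = (if mu = {#} then {0} else {})"
  by (auto simp: monomials_of_type_def)

text \<open>Sort the monomials by the exponent of x_N: either the variable is absent, or its
  exponent is a part \<open>a\<close> and the other variables have the type with one
  \<open>a\<close> removed.\<close>

lemma monomials_of_type_Suc:
  assumes "0 \<notin># mu"
  shows "monomials_of_type (Suc N) mu = monomials_of_type N mu \<union>
    (\<Union>a\<in>set_mset mu. (+) (Poly_Mapping.single N a) ` monomials_of_type N (mu - {#a#}))" (is "?L = ?R")
proof (intro equalityI subsetI)
  fix v assume v: "v \<in> ?L"
  show "v \<in> ?R"
  proof (cases "N \<in> Poly_Mapping.keys v")
    case False
    then show ?thesis using v by (auto simp: monomials_of_type_def less_Suc_eq)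
  next
    case True
    define w where "w = v - Poly_Mapping.single N (Poly_Mapping.lookup v N)"
    have vw: "v = Poly_Mapping.single N (Poly_Mapping.lookup v N) + w"
      unfolding w_def by (intro poly_mapping_eqI)
        (auto simp: lookup_add lookup_minus lookup_single when_def)
    have lw: "Poly_Mapping.lookup w i = (if i = N then 0 else Poly_Mapping.lookup v i)" for i
      by (auto simp: w_def lookup_minus lookup_single when_def)
    have kw: "Poly_Mapping.keys v = insert N (Poly_Mapping.keys w)" "N \<notin> Poly_Mapping.keys w"
      using True by (auto simp: in_keys_iff lw split: if_splits)
    have "mu = image_mset (Poly_Mapping.lookup v) (mset_set (Poly_Mapping.keys v))"
      using v by (simp add: monomials_of_type_def)
    also have "\<dots> = add_mset (Poly_Mapping.lookup v N)
        (image_mset (Poly_Mapping.lookup v) (mset_set (Poly_Mapping.keys w)))"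
      using kw by simp
    also have "image_mset (Poly_Mapping.lookup v) (mset_set (Poly_Mapping.keys w)) =
        image_mset (Poly_Mapping.lookup w) (mset_set (Poly_Mapping.keys w))"
      using kw by (intro image_mset_cong) (auto simp: lw)
    finally have mu: "mu = add_mset (Poly_Mapping.lookup v N)
        (image_mset (Poly_Mapping.lookup w) (mset_set (Poly_Mapping.keys w)))" .
    have "Poly_Mapping.keys w \<subseteq> {..<N}"
      using v kw by (auto simp: monomials_of_type_def less_Suc_eq)
    with mu have "w \<in> monomials_of_type N (mu - {#Poly_Mapping.lookup v N#})"
      by (simp add: monomials_of_type_def)
    moreover have "Poly_Mapping.lookup v N \<in># mu" by (subst mu) simp
    ultimately show ?thesis using vw by blast
  qed
next
  fix v assume "v \<in> ?R"
  then consider "v \<in> monomials_of_type N mu"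
    | a w where "a \<in># mu" "w \<in> monomials_of_type N (mu - {#a#})" "v = Poly_Mapping.single N a + w"
    by blast
  then show "v \<in> ?L"
  proof cases
    case 1
    then show ?thesis by (auto simp: monomials_of_type_def)
  next
    case 2
    have a: "a \<noteq> 0" using 2 assms by metis
    have kw: "Poly_Mapping.keys w \<subseteq> {..<N}" using 2 by (simp add: monomials_of_type_def)
    then have n: "N \<notin> Poly_Mapping.keys w" by auto
    have lv: "Poly_Mapping.lookup v i = (if i = N then a else Poly_Mapping.lookup w i)" for i
      using n by (auto simp: 2 lookup_add lookup_single when_def in_keys_iff)
    have kv: "Poly_Mapping.keys v = insert N (Poly_Mapping.keys w)"
      using a by (auto simp: in_keys_iff lv split: if_splits)
    have "image_mset (Poly_Mapping.lookup v) (mset_set (Poly_Mapping.keys w)) =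
        image_mset (Poly_Mapping.lookup w) (mset_set (Poly_Mapping.keys w))"
      using n by (intro image_mset_cong) (auto simp: lv)
    also have "\<dots> = mu - {#a#}" using 2 by (simp add: monomials_of_type_def)
    finally show ?thesis
      using kw n 2(1) by (auto simp: monomials_of_type_def kv lv)
  qed
qed

lemma sym_m_0: "sym_m 0 mu = (if mu = {#} then 1 else 0)"
  by (simp add: sym_m_def monomials_of_type_0)

lemma lookup_monomials_of_type:
  "v \<in> monomials_of_type N mu \<Longrightarrow> N \<le> i \<Longrightarrow> Poly_Mapping.lookup v i = 0"
  by (auto simp: monomials_of_type_def in_keys_iff)

lemma sym_m_Suc:
  assumes "0 \<notin># mu"
  shows "sym_m (Suc N) mu = sym_m N mu +
    (\<Sum>a\<in>set_mset mu. frag_of (Poly_Mapping.single N a) * sym_m N (mu - {#a#}))"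
proof -
  let ?B = "\<lambda>a. (+) (Poly_Mapping.single N a) ` monomials_of_type N (mu - {#a#})"
  \<comment> \<open>The exponent of x_N identifies the piece, so all the unions are
    disjoint.\<close>
  have l: "Poly_Mapping.lookup v N = a" if "v \<in> ?B a" for v a
    using that by (auto simp: lookup_add lookup_monomials_of_type)
  have d1: "monomials_of_type N mu \<inter> (\<Union>a\<in>set_mset mu. ?B a) = {}"
  proof -
    have False if "v \<in> monomials_of_type N mu" "v \<in> ?B a" "a \<in># mu" for v a
      using l[OF that(2)] lookup_monomials_of_type[OF that(1) order_refl] that(3) assms by metis
    then show ?thesis by blast
  qed
  have d2: "?B a \<inter> ?B b = {}" if "a \<noteq> b" for a b
    by (rule equals0I) (metis IntE l that)
  have "sym_m (Suc N) mu = sym_m N mu + (\<Sum>v\<in>(\<Union>a\<in>set_mset mu. ?B a). frag_of v)"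
    unfolding sym_m_def monomials_of_type_Suc[OF assms]
    by (rule sum.union_disjoint) (use d1 in \<open>auto simp: finite_monomials_of_type\<close>)
  also have "(\<Sum>v\<in>(\<Union>a\<in>set_mset mu. ?B a). frag_of v) = (\<Sum>a\<in>set_mset mu. \<Sum>v\<in>?B a. frag_of v)"
    by (rule sum.UNION_disjoint) (use d2 in \<open>auto simp: finite_monomials_of_type\<close>)
  also have "\<dots> = (\<Sum>a\<in>set_mset mu. frag_of (Poly_Mapping.single N a) * sym_m N (mu - {#a#}))"
    by (intro sum.cong refl, subst sum.reindex)
      (auto simp: sym_m_def sum_distrib_left mult_single)
  finally show ?thesis .
qed

section \<open>Independence of the products of elementary symmetric polynomials\<close>

lemma of_int_dvd_of_int_frag:
  "(of_int q :: 'a::comm_monoid_add \<Rightarrow>\<^sub>0 int) dvd of_int c \<longleftrightarrow> q dvd c"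
proof
  assume "(of_int q :: 'a \<Rightarrow>\<^sub>0 int) dvd of_int c"
  then have "q dvd Poly_Mapping.lookup (of_int c * 1 :: 'a \<Rightarrow>\<^sub>0 int) 0"
    unfolding of_int_dvd_iff_lookup by simp
  then show "q dvd c" unfolding lookup_of_int_mult by simp
next
  assume "q dvd c"
  then show "(of_int q :: 'a \<Rightarrow>\<^sub>0 int) dvd of_int c"
    by (metis dvd_def of_int_mult)
qed

lemma set_var_zero_dvd: "of_int q dvd f \<Longrightarrow> of_int q dvd set_var_zero N f"
  by (metis dvd_def set_var_zero_of_int_mult)

text \<open>Setting x_N = 0 kills every product with a factor e_(N+1), and the surviving
  coefficients are settled in N variables. The remaining products share the factor e_(N+1), a
  monomial that can be cancelled modulo any \<open>q\<close>.\<close>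

lemma sym_e_part_independent:
  fixes q :: int
  assumes "finite S" "\<And>lam. lam \<in> S \<Longrightarrow> set_mset lam \<subseteq> {0<..N}"
    and "of_int q dvd (\<Sum>lam\<in>S. of_int (c lam) * sym_e_part N lam)" "lam \<in> S"
  shows "q dvd c lam"
  using assms
proof (induction N arbitrary: S c lam)
  case 0
  then have "S = {{#}}" by fastforce
  then show ?case using 0 by (simp add: of_int_dvd_of_int_frag)
next
  case (Suc N)
  show ?case using Suc.prems
  \<comment> \<open>Cancelling e_(N+1) takes one part away from every remaining product, so the
    maximal number of parts drops.\<close>
  proof (induction b \<equiv> "Max (size ` S)" arbitrary: S c lam rule: less_induct)
    case less
    let ?E = "sym_e_part (Suc N)"
    define S0 where "S0 = {lam\<in>S. Suc N \<notin># lam}"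
    define S1 where "S1 = {lam\<in>S. Suc N \<in># lam}"
    have S: "S = S0 \<union> S1" "S0 \<inter> S1 = {}" "finite S0" "finite S1"
      using less.prems(1) by (auto simp: S0_def S1_def)
    have "of_int q dvd set_var_zero N (\<Sum>lam\<in>S. of_int (c lam) * ?E lam)"
      using less.prems(3) by (rule set_var_zero_dvd)
    also have "set_var_zero N (\<Sum>lam\<in>S. of_int (c lam) * ?E lam) =
        (\<Sum>lam\<in>S. of_int (c lam) * sym_e_part N lam)"
      by (simp add: set_var_zero_sum set_var_zero_of_int_mult set_var_zero_sym_e_part)
    also have "\<dots> = (\<Sum>lam\<in>S0. of_int (c lam) * sym_e_part N lam)"
      by (rule sum.mono_neutral_right) (use less.prems(1) in \<open>auto simp: S0_def sym_e_part_eq_0\<close>)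
    finally have q0: "of_int q dvd (\<Sum>lam\<in>S0. of_int (c lam) * sym_e_part N lam)" .
    have S0: "q dvd c lam" if "lam \<in> S0" for lam
    proof (rule Suc.IH[OF S(3) _ q0 that])
      fix lam assume "lam \<in> S0"
      then have "set_mset lam \<subseteq> {0<..Suc N}" "Suc N \<notin># lam"
        using less.prems(2) by (auto simp: S0_def)
      then show "set_mset lam \<subseteq> {0<..N}" by (force simp: le_Suc_eq)
    qed
    show ?case
    proof (cases "lam \<in> S0")
      case False
      then have lam: "lam \<in> S1" using less.prems(4) S by auto
      define S' where "S' = (\<lambda>lam. lam - {#Suc N#}) ` S1"
      have S1: "S1 = add_mset (Suc N) ` S'"
        by (force simp: S'_def S1_def image_image)
      have inj: "inj_on (add_mset (Suc N)) S'" by (auto simp: inj_on_def)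
      have "of_int q dvd (\<Sum>lam\<in>S0. of_int (c lam) * ?E lam)"
        by (intro dvd_sum dvd_mult2) (use S0 of_int_dvd_of_int_frag in blast)
      then have "of_int q dvd (\<Sum>lam\<in>S1. of_int (c lam) * ?E lam)"
        using less.prems(3) unfolding S(1) sum.union_disjoint[OF S(3,4,2)]
        by (simp only: dvd_add_right_iff)
      also have "(\<Sum>lam\<in>S1. of_int (c lam) * ?E lam) =
          sym_e (Suc N) (Suc N) * (\<Sum>lam\<in>S'. of_int (c (add_mset (Suc N) lam)) * ?E lam)"
        unfolding S1 sum.reindex[OF inj] by (simp add: sum_distrib_left mult.left_commute)
      finally have q': "of_int q dvd (\<Sum>lam\<in>S'. of_int (c (add_mset (Suc N) lam)) * ?E lam)"
        unfolding sym_e_self by (rule of_int_dvd_frag_of_mult)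
      have fin': "finite S'" using S by (simp add: S'_def)
      have lam': "lam - {#Suc N#} \<in> S'" using lam by (auto simp: S'_def)
      have "size lam' < Max (size ` S)" if "lam' \<in> S'" for lam'
      proof -
        have "add_mset (Suc N) lam' \<in> S" using that S1 S by auto
        then have "size (add_mset (Suc N) lam') \<le> Max (size ` S)"
          by (intro Max_ge imageI) (use less.prems(1) in auto)
        then show ?thesis by simp
      qed
      then have "Max (size ` S') < Max (size ` S)"
        using fin' lam' by (subst Max_less_iff) auto
      moreover have "set_mset lam' \<subseteq> {0<..Suc N}" if "lam' \<in> S'" for lam'
      proof -
        have "add_mset (Suc N) lam' \<in> S" using that S1 S by auto
        from less.prems(2)[OF this] show ?thesis by simp
      qed
      ultimately have "q dvd c (add_mset (Suc N) (lam - {#Suc N#}))"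
        using less.hyps[OF _ fin' _ q' lam'] by blast
      then show ?thesis using lam by (simp add: S1_def)
    qed (rule S0)
  qed
qed

section \<open>The fundamental theorem of symmetric functions\<close>

definition mdeg :: "(nat \<Rightarrow>\<^sub>0 nat) \<Rightarrow> nat" where
  "mdeg v = (\<Sum>i\<in>Poly_Mapping.keys v. Poly_Mapping.lookup v i)"

definition homog :: "nat \<Rightarrow> xpoly \<Rightarrow> bool" where
  "homog d f \<longleftrightarrow> (\<forall>v\<in>Poly_Mapping.keys f. mdeg v = d)"

lemma mdeg_superset:
  "finite A \<Longrightarrow> Poly_Mapping.keys v \<subseteq> A \<Longrightarrow> mdeg v = (\<Sum>i\<in>A. Poly_Mapping.lookup v i)"
  unfolding mdeg_def by (rule sum.mono_neutral_left) (auto simp: in_keys_iff)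

lemma mdeg_add: "mdeg (v + w) = mdeg v + mdeg w"
proof -
  let ?A = "Poly_Mapping.keys v \<union> Poly_Mapping.keys w"
  have "mdeg (v + w) = (\<Sum>i\<in>?A. Poly_Mapping.lookup (v + w) i)"
    by (rule mdeg_superset) (auto simp: in_keys_iff lookup_add)
  then show ?thesis
    by (simp add: lookup_add sum.distrib mdeg_superset[of ?A v] mdeg_superset[of ?A w])
qed

lemma mdeg_single [simp]: "mdeg (Poly_Mapping.single i n) = n"
  by (auto simp: mdeg_def)

lemma mdeg_zero [simp]: "mdeg 0 = 0"
  by (simp add: mdeg_def)

lemma mdeg_sum: "mdeg (\<Sum>i\<in>I. g i) = (\<Sum>i\<in>I. mdeg (g i))"
  by (induction I rule: infinite_finite_induct) (simp_all add: mdeg_add)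

lemma homog_zero [simp]: "homog d 0"
  by (simp add: homog_def)

lemma homog_one [simp]: "homog 0 1"
  unfolding homog_def single_one[symmetric] by simp

lemma homog_add: "homog d f \<Longrightarrow> homog d g \<Longrightarrow> homog d (f + g)"
  unfolding homog_def using Poly_Mapping.keys_add[of f g] by blast

lemma homog_diff: "homog d f \<Longrightarrow> homog d g \<Longrightarrow> homog d (f - g)"
  unfolding homog_def using keys_diff[of f g] by blast

lemma homog_sum: "(\<And>i. i \<in> I \<Longrightarrow> homog d (g i)) \<Longrightarrow> homog d (\<Sum>i\<in>I. g i)"
  by (induction I rule: infinite_finite_induct) (simp_all add: homog_add)

lemma homog_mult: "homog d f \<Longrightarrow> homog d' g \<Longrightarrow> homog (d + d') (f * g)"
  unfolding homog_def using keys_mult[of f g] by (auto simp: mdeg_add)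

lemma homog_of_int_mult: "homog d f \<Longrightarrow> homog d (of_int c * f)"
  unfolding homog_def by (simp flip: frag_cmul_conv)

lemma homog_frag_of: "homog (mdeg m) (frag_of m)"
  by (simp add: homog_def)

lemma homog_xvar: "homog 1 (xvar i)"
  using homog_frag_of[of "Poly_Mapping.single i 1"] by (simp add: xvar_def)

lemma homog_sym_e: "homog r (sym_e N r)"
proof (induction N arbitrary: r)
  case 0
  then show ?case by (cases r) (simp_all add: sym_e_0_Suc)
next
  case (Suc N)
  then show ?case
    using homog_mult[OF homog_xvar Suc.IH]
    by (cases r) (auto simp: sym_e_Suc_Suc intro!: homog_add)
qed

lemma homog_sym_e_part: "homog (sum_mset lam) (sym_e_part N lam)"
  by (induction lam) (auto intro: homog_mult homog_sym_e)

lemma homog_sym_m: "homog (sum_mset mu) (sym_m N mu)"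
  unfolding sym_m_def
proof (rule homog_sum)
  fix v assume "v \<in> monomials_of_type N mu"
  then have "sum_mset mu = mdeg v"
    by (auto simp: monomials_of_type_def mdeg_def sum_unfold_sum_mset)
  then show "homog (sum_mset mu) (frag_of v)" by (simp add: homog_frag_of)
qed

section \<open>Symmetry under permutations of the first \<open>N\<close> variables\<close>

definition permute_vars :: "(nat \<Rightarrow> nat) \<Rightarrow> xpoly \<Rightarrow> xpoly" where
  "permute_vars \<pi> = frag_extend (\<lambda>m. frag_of (Poly_Mapping.map_key \<pi> m))"

definition symmetric_in :: "nat \<Rightarrow> xpoly \<Rightarrow> bool" where
  "symmetric_in N f \<longleftrightarrow> (\<forall>v\<in>Poly_Mapping.keys f. Poly_Mapping.keys v \<subseteq> {..<N}) \<and>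
     (\<forall>\<pi>. \<pi> permutes {..<N} \<longrightarrow> permute_vars \<pi> f = f)"

lemma permute_vars_mult:
  "\<pi> permutes A \<Longrightarrow> permute_vars \<pi> (f * g) = permute_vars \<pi> f * permute_vars \<pi> g"
  unfolding permute_vars_def
  by (rule frag_extend_mult) (simp add: map_key_plus permutes_inj frag_of_mult)

lemma permute_vars_diff: "permute_vars \<pi> (f - g) = permute_vars \<pi> f - permute_vars \<pi> g"
  unfolding permute_vars_def by (rule frag_extend_diff)

lemma permute_vars_sum: "permute_vars \<pi> (\<Sum>i\<in>I. g i) = (\<Sum>i\<in>I. permute_vars \<pi> (g i))"
  unfolding permute_vars_def by (rule frag_extend_sum')

lemma permute_vars_of_int_mult: "permute_vars \<pi> (of_int c * f) = of_int c * permute_vars \<pi> f"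
  unfolding permute_vars_def by (rule frag_extend_of_int_mult)

lemma permute_vars_one: "\<pi> permutes A \<Longrightarrow> permute_vars \<pi> 1 = 1"
  unfolding permute_vars_def single_one[symmetric] frag_extend_of
  by (simp add: map_key_zero permutes_inj)

text \<open>The inverse appears because \<open>map_key\<close> composes the exponent function with
  \<pi>. Symmetry quantifies over all permutations, so the direction is immaterial there.\<close>

lemma permute_vars_xvar:
  assumes "\<pi> permutes A"
  shows "permute_vars \<pi> (xvar i) = xvar (inv \<pi> i)"
proof -
  have "Poly_Mapping.map_key \<pi> (Poly_Mapping.single (\<pi> (inv \<pi> i)) (1::nat)) = Poly_Mapping.single (inv \<pi> i) 1"
    using assms by (intro map_key_single) (simp add: permutes_inj)
  then show ?thesis
    using assms by (simp add: permute_vars_def xvar_def permutes_inverses)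
qed

lemma map_key_inject:
  assumes "\<pi> permutes A" "Poly_Mapping.map_key \<pi> v = Poly_Mapping.map_key \<pi> w"
  shows "v = w"
proof (rule poly_mapping_eqI)
  fix i
  have "Poly_Mapping.lookup (Poly_Mapping.map_key \<pi> v) (inv \<pi> i) =
        Poly_Mapping.lookup (Poly_Mapping.map_key \<pi> w) (inv \<pi> i)"
    using assms by simp
  then show "Poly_Mapping.lookup v i = Poly_Mapping.lookup w i"
    using assms(1) by (simp add: map_key.rep_eq permutes_inj permutes_inverses)
qed

lemma lookup_permute_vars:
  assumes "\<pi> permutes A"
  shows "Poly_Mapping.lookup (permute_vars \<pi> f) (Poly_Mapping.map_key \<pi> v) = Poly_Mapping.lookup f v"
proof (induction f rule: frag_induct)
  case (of m)
  then show ?case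
    using map_key_inject[OF assms] by (auto simp: permute_vars_def lookup_single when_def)
qed (simp_all add: permute_vars_diff lookup_minus, simp add: permute_vars_def)

lemma symmetric_in_mult: "symmetric_in N f \<Longrightarrow> symmetric_in N g \<Longrightarrow> symmetric_in N (f * g)"
proof -
  assume fg: "symmetric_in N f" "symmetric_in N g"
  have "Poly_Mapping.keys v \<subseteq> {..<N}" if v: "v \<in> Poly_Mapping.keys (f * g)" for v
  proof -
    obtain a b where "v = a + b" "a \<in> Poly_Mapping.keys f" "b \<in> Poly_Mapping.keys g"
      using v keys_mult[of f g] by blast
    then show ?thesis
      using fg Poly_Mapping.keys_add[of a b] unfolding symmetric_in_def by blast
  qed
  then show ?thesis using fg by (auto simp: symmetric_in_def permute_vars_mult)
qed

lemma symmetric_in_diff: "symmetric_in N f \<Longrightarrow> symmetric_in N g \<Longrightarrow> symmetric_in N (f - g)"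
  unfolding symmetric_in_def using keys_diff[of f g] by (simp add: permute_vars_diff) blast

lemma symmetric_in_of_int_mult: "symmetric_in N f \<Longrightarrow> symmetric_in N (of_int c * f)"
  unfolding symmetric_in_def by (auto simp: permute_vars_of_int_mult) (auto simp flip: frag_cmul_conv)

lemma symmetric_in_sum:
  assumes "\<And>i. i \<in> I \<Longrightarrow> symmetric_in N (g i)"
  shows "symmetric_in N (\<Sum>i\<in>I. g i)"
  using assms Poly_Mapping.keys_sum[of g I] unfolding symmetric_in_def
  by (force simp: permute_vars_sum intro!: sum.cong)

lemma symmetric_in_one: "symmetric_in N 1"
  unfolding symmetric_in_def by (auto simp: permute_vars_one)

lemma keys_keys_sym_e:
  "v \<in> Poly_Mapping.keys (sym_e N r) \<Longrightarrow> Poly_Mapping.keys v \<subseteq> {..<N}"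
proof (induction N arbitrary: r v)
  case 0
  then show ?case by (cases r) (auto simp: sym_e_0_Suc simp flip: single_one)
next
  case (Suc N)
  show ?case
  proof (cases r)
    case 0
    then show ?thesis using Suc.prems by (auto simp flip: single_one)
  next
    case (Suc r')
    with Suc.prems have "v \<in> Poly_Mapping.keys (sym_e N (Suc r')) \<union>
        Poly_Mapping.keys (xvar N * sym_e N r')"
      using Poly_Mapping.keys_add[of "sym_e N (Suc r')" "xvar N * sym_e N r'"]
      by (auto simp: sym_e_Suc_Suc)
    then consider "v \<in> Poly_Mapping.keys (sym_e N (Suc r'))"
      | w where "v = Poly_Mapping.single N 1 + w" "w \<in> Poly_Mapping.keys (sym_e N r')"
      using keys_mult[of "xvar N" "sym_e N r'"] by (auto simp: xvar_def)
    then show ?thesis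
    proof cases
      case 1
      then show ?thesis using Suc.IH by fastforce
    next
      case 2
      then show ?thesis
        using Suc.IH[OF 2(2)] Poly_Mapping.keys_add[of "Poly_Mapping.single N 1" w]
        by (fastforce simp: less_Suc_eq)
    qed
  qed
qed

lemma symmetric_in_sym_e: "symmetric_in N (sym_e N r)"
proof -
  have "permute_vars \<pi> (sym_e N r) = sym_e N r" if \<pi>: "\<pi> permutes {..<N}" for \<pi>
  proof -
    let ?A = "{S. S \<subseteq> {..<N} \<and> card S = r}"
    have inv: "inv \<pi> permutes {..<N}" using \<pi> by (rule permutes_inv)
    have inj: "inj (inv \<pi>)" using inv by (rule permutes_inj)
    have "permute_vars \<pi> (\<Prod>i\<in>S. xvar i) = (\<Prod>i\<in>S. xvar (inv \<pi> i))" for S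
      by (induction S rule: infinite_finite_induct)
        (use \<pi> in \<open>auto simp: permute_vars_one permute_vars_mult permute_vars_xvar\<close>)
    then have "permute_vars \<pi> (sym_e N r) = (\<Sum>S\<in>?A. \<Prod>i\<in>S. xvar (inv \<pi> i))"
      unfolding sym_e_alt by (simp add: permute_vars_sum)
    also have "\<dots> = (\<Sum>S\<in>?A. \<Prod>i\<in>inv \<pi> ` S. xvar i)"
      by (intro sum.cong refl, subst prod.reindex) (use inj in \<open>auto intro: inj_on_subset\<close>)
    also have "\<dots> = (\<Sum>S\<in>(`) (inv \<pi>) ` ?A. \<Prod>i\<in>S. xvar i)"
      by (subst sum.reindex) (use inj in \<open>auto simp: inj_on_def inj_image_eq_iff\<close>)
    also have "(`) (inv \<pi>) ` ?A = ?A"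
    proof (rule endo_inj_surj)
      show "finite ?A" by (rule finite_subset[of _ "Pow {..<N}"]) auto
      show "(`) (inv \<pi>) ` ?A \<subseteq> ?A"
        using inj permutes_in_image[OF inv] by (fastforce simp: card_image inj_on_subset)
    qed (use inj in \<open>auto simp: inj_on_def inj_image_eq_iff\<close>)
    finally show ?thesis by (simp add: sym_e_alt)
  qed
  then show ?thesis using keys_keys_sym_e by (simp add: symmetric_in_def)
qed

lemma symmetric_in_sym_e_part: "symmetric_in N (sym_e_part N lam)"
  by (induction lam) (simp_all add: symmetric_in_one symmetric_in_mult symmetric_in_sym_e)

lemma symmetric_in_sym_m: "symmetric_in N (sym_m N mu)"
proof -
  let ?M = "monomials_of_type N mu"
  have "permute_vars \<pi> (sym_m N mu) = sym_m N mu" if \<pi>: "\<pi> permutes {..<N}" for \<pi>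
  proof -
    let ?k = "Poly_Mapping.map_key \<pi> :: (nat \<Rightarrow>\<^sub>0 nat) \<Rightarrow> _"
    have inj: "inj_on ?k ?M" using map_key_inject[OF \<pi>] by (auto simp: inj_on_def)
    have "?k v \<in> ?M" if "v \<in> ?M" for v
    proof -
      have kv: "Poly_Mapping.keys v \<subseteq> {..<N}" using that by (simp add: monomials_of_type_def)
      have k: "Poly_Mapping.keys (?k v) = \<pi> -` Poly_Mapping.keys v"
        using \<pi> by (simp add: keys_map_key permutes_inj)
      have l: "Poly_Mapping.lookup (?k v) = Poly_Mapping.lookup v \<circ> \<pi>"
        using \<pi> by (simp add: map_key.rep_eq permutes_inj)
      have "image_mset (Poly_Mapping.lookup v \<circ> \<pi>) (mset_set (\<pi> -` Poly_Mapping.keys v)) =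
          image_mset (Poly_Mapping.lookup v) (image_mset \<pi> (mset_set (\<pi> -` Poly_Mapping.keys v)))"
        by (simp add: multiset.map_comp)
      also have "image_mset \<pi> (mset_set (\<pi> -` Poly_Mapping.keys v)) = mset_set (Poly_Mapping.keys v)"
        using \<pi> by (subst image_mset_mset_set)
          (auto simp: surj_image_vimage_eq permutes_surj intro: inj_on_subset[OF permutes_inj])
      finally have "image_mset (Poly_Mapping.lookup (?k v)) (mset_set (Poly_Mapping.keys (?k v))) = mu"
        using that unfolding monomials_of_type_def k l by (simp add: comp_def)
      moreover have "\<pi> -` Poly_Mapping.keys v \<subseteq> {..<N}"
        using kv permutes_in_image[OF \<pi>] by blast
      ultimately show ?thesis by (simp add: monomials_of_type_def k)
    qed
    then have "?k ` ?M = ?M"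
      by (intro endo_inj_surj inj) (auto simp: finite_monomials_of_type)
    then have "(\<Sum>v\<in>?M. frag_of v) = (\<Sum>v\<in>?M. frag_of (?k v))"
      using sum.reindex[OF inj, of frag_of] by simp
    also have "\<dots> = permute_vars \<pi> (\<Sum>v\<in>?M. frag_of v)"
      unfolding permute_vars_sum by (simp add: permute_vars_def)
    finally show ?thesis by (simp add: sym_m_def)
  qed
  moreover have "Poly_Mapping.keys v \<subseteq> {..<N}" if "v \<in> Poly_Mapping.keys (sym_m N mu)" for v
    using that Poly_Mapping.keys_sum[of frag_of ?M] by (auto simp: sym_m_def monomials_of_type_def)
  ultimately show ?thesis by (simp add: symmetric_in_def)
qed

lemma homog_zero_vars:
  assumes "symmetric_in 0 f" "homog d f"
  shows "f = (if d = 0 then of_int (Poly_Mapping.lookup f 0) else 0)"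
proof (rule poly_mapping_eqI)
  fix v
  have "v = 0" "d = 0" if "v \<in> Poly_Mapping.keys f"
  proof -
    show "v = 0" using assms that by (force simp: symmetric_in_def)
    then show "d = 0" using assms that by (auto simp: homog_def)
  qed
  then have "Poly_Mapping.lookup f v = 0" if "v \<noteq> 0 \<or> d \<noteq> 0"
    using that by (metis in_keys_iff)
  moreover have "Poly_Mapping.lookup (of_int c) w = (if w = 0 then c else 0)"
    for c and w :: "nat \<Rightarrow>\<^sub>0 nat"
    using lookup_of_int_mult[of c 1 w] by (simp add: lookup_one when_def)
  ultimately show "Poly_Mapping.lookup f v =
      Poly_Mapping.lookup (if d = 0 then of_int (Poly_Mapping.lookup f 0) else 0) v"
    by auto
qed

lemma mdeg_all_vars: "mdeg (all_vars N) = N"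
  by (simp add: all_vars_def mdeg_sum)

lemma lookup_all_vars: "Poly_Mapping.lookup (all_vars N) i = (if i < N then 1 else 0)"
  by (auto simp: all_vars_def lookup_sum lookup_single when_def)

lemma frag_extend_frag_of_mult:
  fixes b :: "'b \<Rightarrow> 'a::comm_monoid_add \<Rightarrow>\<^sub>0 int"
  shows "g * frag_extend b f = frag_extend (\<lambda>m. g * b m) f"
  by (simp add: frag_extend_def sum_distrib_left frag_cmul_conv mult_ac)

lemma frag_of_mult_left_cancel:
  fixes f :: "'a::cancel_comm_monoid_add \<Rightarrow>\<^sub>0 int"
  assumes "frag_of m * f = frag_of m * g"
  shows "f = g"
  by (rule poly_mapping_eqI) (metis assms lookup_frag_of_mult)

text \<open>By symmetry, vanishing at \<open>x\<^sub>N = 0\<close> means vanishing at every \<open>x\<^sub>i = 0\<close>, that is,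
  divisibility by \<open>x\<^sub>0 \<cdots> x\<^sub>N = e\<^bsub>N+1\<^esub>\<close>.\<close>

lemma symmetric_divisible:
  assumes f: "symmetric_in (Suc N) f" "homog d f" and z: "set_var_zero N f = 0"
  obtains g where "f = sym_e (Suc N) (Suc N) * g" "symmetric_in (Suc N) g"
    "homog (d - Suc N) g" "d < Suc N \<Longrightarrow> g = 0"
proof
  let ?u = "all_vars (Suc N)"
  define g where "g = frag_extend (\<lambda>v. frag_of (v - ?u)) f"
  have nz: "Poly_Mapping.lookup v i \<noteq> 0" if v: "v \<in> Poly_Mapping.keys f" and i: "i < Suc N" for v i
  proof
    assume l: "Poly_Mapping.lookup v i = 0"
    let ?t = "Transposition.transpose i N"
    have t: "?t permutes {..<Suc N}" using i by (intro permutes_swap_id) auto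
    have "Poly_Mapping.lookup f (Poly_Mapping.map_key ?t v) = Poly_Mapping.lookup f v"
      using lookup_permute_vars[OF t, of f v] f(1) t by (simp add: symmetric_in_def)
    moreover have "Poly_Mapping.lookup (Poly_Mapping.map_key ?t v) N = 0"
      using l by (simp add: map_key.rep_eq)
    ultimately have "Poly_Mapping.lookup (set_var_zero N f) (Poly_Mapping.map_key ?t v) =
        Poly_Mapping.lookup f v"
      by (simp add: lookup_set_var_zero)
    then show False using z v by (simp add: in_keys_iff)
  qed
  have u: "?u + (v - ?u) = v" if "v \<in> Poly_Mapping.keys f" for v
  proof (rule poly_mapping_eqI)
    fix i
    show "Poly_Mapping.lookup (?u + (v - ?u)) i = Poly_Mapping.lookup v i"
      unfolding lookup_add lookup_minus lookup_all_vars using nz[OF that, of i] by auto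
  qed
  have "frag_of ?u * g = frag_extend (\<lambda>v. frag_of (?u + (v - ?u))) f"
    unfolding g_def frag_extend_frag_of_mult frag_of_mult[symmetric] ..
  also have "\<dots> = frag_extend frag_of f" by (rule frag_extend_eq) (simp only: u)
  finally have fg: "f = frag_of ?u * g" by (simp only: frag_expansion[symmetric])
  then show "f = sym_e (Suc N) (Suc N) * g" by (simp only: sym_e_self)
  have keys: "?u + v \<in> Poly_Mapping.keys f" if "v \<in> Poly_Mapping.keys g" for v
    using that unfolding in_keys_iff by (subst fg) (simp only: lookup_frag_of_mult not_False_eq_True)
  have deg: "mdeg v = d - Suc N" "d \<ge> Suc N" if "v \<in> Poly_Mapping.keys g" for v
  proof -
    have "mdeg (?u + v) = d" using keys[OF that] f(2) by (simp only: homog_def)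
    then have "Suc N + mdeg v = d" by (simp add: mdeg_add mdeg_all_vars)
    then show "mdeg v = d - Suc N" "d \<ge> Suc N" by auto
  qed
  then show "homog (d - Suc N) g" by (simp add: homog_def)
  \<comment> \<open>Below degree \<open>Suc N\<close> the truncated \<open>d - Suc N\<close> is 0
    and would admit a nonzero constant \<open>g\<close>, which the true degrees exclude.\<close>
  show "g = 0" if "d < Suc N" using deg(2) that by (metis all_not_in_conv keys_eq_empty leD)
  have "Poly_Mapping.keys v \<subseteq> {..<Suc N}" if "v \<in> Poly_Mapping.keys g" for v
  proof -
    have "Poly_Mapping.keys (?u + v) \<subseteq> {..<Suc N}" using keys[OF that] f(1) by (simp only: symmetric_in_def)
    moreover have "Poly_Mapping.keys v \<subseteq> Poly_Mapping.keys (?u + v)"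
      by (auto simp only: in_keys_iff lookup_add)
    ultimately show ?thesis by (rule order_trans[rotated])
  qed
  moreover have "permute_vars \<pi> g = g" if \<pi>: "\<pi> permutes {..<Suc N}" for \<pi>
  proof (rule frag_of_mult_left_cancel)
    have "permute_vars \<pi> (frag_of ?u) = frag_of ?u"
      using symmetric_in_sym_e[of "Suc N" "Suc N"] \<pi> unfolding sym_e_self symmetric_in_def by metis
    then have "frag_of ?u * permute_vars \<pi> g = permute_vars \<pi> f"
      by (subst fg) (simp only: permute_vars_mult[OF \<pi>])
    also have "\<dots> = frag_of ?u * g" using f(1) \<pi> fg by (simp only: symmetric_in_def)
    finally show "frag_of ?u * permute_vars \<pi> g = frag_of ?u * g" .
  qed
  ultimately show "symmetric_in (Suc N) g" by (simp add: symmetric_in_def)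
qed

lemma symmetric_in_set_var_zero:
  assumes "symmetric_in (Suc N) f"
  shows "symmetric_in N (set_var_zero N f)"
proof -
  have "Poly_Mapping.keys v \<subseteq> {..<N}" if "v \<in> Poly_Mapping.keys (set_var_zero N f)" for v
  proof -
    have "v \<in> Poly_Mapping.keys f" "N \<notin> Poly_Mapping.keys v"
      using that by (auto simp: in_keys_iff lookup_set_var_zero split: if_splits)
    then have "Poly_Mapping.keys v \<subseteq> {..<Suc N} - {N}" using assms by (auto simp: symmetric_in_def)
    then show ?thesis by auto
  qed
  moreover have "permute_vars \<pi> (set_var_zero N f) = set_var_zero N f" if \<pi>: "\<pi> permutes {..<N}" for \<pi>
  proof -
    have "\<pi> N = N" using \<pi> by (simp add: permutes_not_in)
    then have "permute_vars \<pi> (set_var_zero N f) = set_var_zero N (permute_vars \<pi> f)"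
      using \<pi> unfolding permute_vars_def set_var_zero_def
      by (induction f rule: frag_induct)
        (simp_all add: frag_extend_diff map_key.rep_eq permutes_inj)
    moreover have "\<pi> permutes {..<Suc N}" using \<pi> by (rule permutes_subset) auto
    ultimately show ?thesis using assms by (simp add: symmetric_in_def)
  qed
  ultimately show ?thesis by (simp add: symmetric_in_def)
qed

lemma homog_set_var_zero: "homog d f \<Longrightarrow> homog d (set_var_zero N f)"
  unfolding homog_def by (auto simp: in_keys_iff lookup_set_var_zero split: if_splits)

text \<open>The classical double induction. The expansion of \<open>f\<close> at x_N = 0, reread
  with one more variable, differs from \<open>f\<close> by a symmetric polynomial that vanishes at
  x_N = 0; that is e_(N+1) times a symmetric polynomial of smaller degree.\<close>

lemma symmetric_in_sym_e_span:
  assumes "symmetric_in N f" "homog d f"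
  shows "\<exists>a. (\<forall>lam. a lam \<noteq> 0 \<longrightarrow> lam \<in> partitions_of d \<and> set_mset lam \<subseteq> {0<..N}) \<and>
    f = (\<Sum>lam\<in>partitions_of d. of_int (a lam) * sym_e_part N lam)"
  using assms
proof (induction N arbitrary: f d)
  case 0
  define a where "a = (\<lambda>lam :: partition. if lam = {#} \<and> d = 0 then Poly_Mapping.lookup f 0 else 0)"
  have "(\<Sum>lam\<in>partitions_of d. of_int (a lam) * sym_e_part 0 lam) = f"
  proof (cases "d = 0")
    case True
    have "partitions_of 0 = {{#}}"
      by (auto simp: partitions_of_def is_partition_def sum_mset_0_iff intro: multiset_nonemptyE)
    then show ?thesis
      using homog_zero_vars[OF 0] True by (simp add: a_def)
  next
    case False
    then show ?thesis using homog_zero_vars[OF 0] by (simp add: a_def)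
  qed
  then show ?case
    by (intro exI[of _ a]) (auto simp: a_def partitions_of_def is_partition_def)
next
  case (Suc N)
  show ?case using Suc.prems
  proof (induction d arbitrary: f rule: less_induct)
    case (less d)
    let ?E = "sym_e_part (Suc N)"
    obtain a where a: "\<And>lam. a lam \<noteq> 0 \<Longrightarrow> lam \<in> partitions_of d \<and> set_mset lam \<subseteq> {0<..N}"
      "set_var_zero N f = (\<Sum>lam\<in>partitions_of d. of_int (a lam) * sym_e_part N lam)"
      using Suc.IH[OF symmetric_in_set_var_zero homog_set_var_zero] less.prems by blast
    define f' where "f' = f - (\<Sum>lam\<in>partitions_of d. of_int (a lam) * ?E lam)"
    have hom: "homog d (of_int (a lam) * ?E lam)" if "lam \<in> partitions_of d" for lam
      using homog_sym_e_part[of lam "Suc N"] that by (auto simp: partitions_of_def homog_of_int_mult)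
    have "symmetric_in (Suc N) f'" unfolding f'_def
      using less.prems by (intro symmetric_in_diff symmetric_in_sum symmetric_in_of_int_mult symmetric_in_sym_e_part)
    moreover have "homog d f'" unfolding f'_def
      using less.prems hom by (intro homog_diff homog_sum)
    moreover have "set_var_zero N f' = 0"
      unfolding f'_def
      by (simp add: set_var_zero_diff set_var_zero_sum set_var_zero_of_int_mult set_var_zero_sym_e_part a(2))
    ultimately obtain g where g: "f' = sym_e (Suc N) (Suc N) * g" "symmetric_in (Suc N) g"
      "homog (d - Suc N) g" "d < Suc N \<Longrightarrow> g = 0"
      using symmetric_divisible by blast
    obtain b where b: "\<And>lam. b lam \<noteq> 0 \<Longrightarrow>
        lam \<in> partitions_of (d - Suc N) \<and> set_mset lam \<subseteq> {0<..Suc N} \<and> d \<ge> Suc N"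
      "g = (\<Sum>lam\<in>partitions_of (d - Suc N). of_int (b lam) * ?E lam)"
    proof (cases "d < Suc N")
      case True
      show ?thesis by (rule that[of "\<lambda>_. 0"]) (use g(4)[OF True] in auto)
    next
      case False
      then have "d - Suc N < d" "d \<ge> Suc N" by auto
      then show ?thesis using less.IH[OF _ g(2,3)] that by blast
    qed
    \<comment> \<open>The coefficients of e_(N+1) times \<open>g\<close>: every partition in the
      expansion of \<open>g\<close> receives a part \<open>Suc N\<close>.\<close>
    define b' where "b' = (\<lambda>lam. if Suc N \<in># lam then b (lam - {#Suc N#}) else 0)"
    have f'b: "f' = (\<Sum>lam\<in>partitions_of d. of_int (b' lam) * ?E lam)"
    proof (cases "d < Suc N")
      case True
      then have "b = (\<lambda>_. 0)" using b(1) by force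
      then show ?thesis using g(4)[OF True] g(1) by (simp add: b'_def cong: if_cong)
    next
      case False
      have inj: "inj_on (add_mset (Suc N)) (partitions_of (d - Suc N))" by (auto simp: inj_on_def)
      have sub: "add_mset (Suc N) ` partitions_of (d - Suc N) \<subseteq> partitions_of d"
        using False by (auto simp: partitions_of_def is_partition_def)
      have out: "b' lam = 0" if "lam \<notin> add_mset (Suc N) ` partitions_of (d - Suc N)" for lam
        using that b(1) unfolding b'_def by (metis image_eqI insert_DiffM)
      have "f' = (\<Sum>lam\<in>add_mset (Suc N) ` partitions_of (d - Suc N). of_int (b' lam) * ?E lam)"
        unfolding g(1) b(2) sum.reindex[OF inj] by (simp add: b'_def sum_distrib_left mult_ac)
      also have "\<dots> = (\<Sum>lam\<in>partitions_of d. of_int (b' lam) * ?E lam)"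
        by (rule sum.mono_neutral_left) (use sub out finite_partitions_of in auto)
      finally show ?thesis .
    qed
    have b'0: "lam \<in> partitions_of d \<and> set_mset lam \<subseteq> {0<..Suc N}" if "b' lam \<noteq> 0" for lam
    proof -
      have l: "Suc N \<in># lam" "b (lam - {#Suc N#}) \<noteq> 0"
        using that by (auto simp: b'_def split: if_splits)
      then obtain kap where kap: "lam = add_mset (Suc N) kap" by (metis insert_DiffM)
      with l b(1)[of kap] show ?thesis by (auto simp: partitions_of_def is_partition_def)
    qed
    define c where "c = (\<lambda>lam. a lam + b' lam)"
    have "f = (\<Sum>lam\<in>partitions_of d. of_int (c lam) * ?E lam)"
      using f'b unfolding f'_def c_def by (simp add: algebra_simps sum.distrib)
    moreover have "lam \<in> partitions_of d \<and> set_mset lam \<subseteq> {0<..Suc N}" if "c lam \<noteq> 0" for lam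
    proof -
      have "a lam \<noteq> 0 \<or> b' lam \<noteq> 0" using that by (auto simp: c_def)
      then show ?thesis using a(1)[of lam] b'0[of lam] by fastforce
    qed
    ultimately show ?case by blast
  qed
qed

section \<open>Coefficients that are valid for every number of variables\<close>

lemma set_var_zero_sym_m_le: "0 \<notin># mu \<Longrightarrow> N' \<le> N \<Longrightarrow> set_var_zero N (sym_m N' mu) = sym_m N' mu"
  unfolding sym_m_def set_var_zero_sum
  by (intro sum.cong refl) (simp add: set_var_zero_def lookup_monomials_of_type)

lemma set_var_zero_single_mult:
  "a \<noteq> 0 \<Longrightarrow> set_var_zero N (frag_of (Poly_Mapping.single N a) * f) = 0"
  unfolding set_var_zero_mult by (simp add: set_var_zero_def)

lemma set_var_zero_sym_m: "0 \<notin># mu \<Longrightarrow> set_var_zero N (sym_m (Suc N) mu) = sym_m N mu"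
  by (simp add: sym_m_Suc set_var_zero_add set_var_zero_sum set_var_zero_sym_m_le)
    (intro sum.neutral ballI set_var_zero_single_mult, metis)

lemma partitions_of_parts:
  assumes "lam \<in> partitions_of d" "d \<le> N"
  shows "set_mset lam \<subseteq> {0<..N}"
proof
  fix x assume x: "x \<in># lam"
  then have "x \<le> sum_mset lam" by (auto dest: multi_member_split)
  moreover have "x \<noteq> 0" using x assms by (metis is_partition_def mem_Collect_eq partitions_of_def)
  ultimately show "x \<in> {0<..N}" using assms by (auto simp: partitions_of_def)
qed

text \<open>The coefficients found in |mu| variables serve for all N. Setting a variable to zero
  carries the expansion downwards. Upwards, any expansion in N + 1 variables restricts to one in N
  variables, where independence forces it to have the known coefficients.\<close>

lemma sym_m_sym_e_span:
  assumes "is_partition mu"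
  shows "\<exists>a. (\<forall>lam. a lam \<noteq> 0 \<longrightarrow> lam \<in> partitions_of (sum_mset mu)) \<and>
    (\<forall>N. sym_m N mu = (\<Sum>lam\<in>partitions_of (sum_mset mu). of_int (a lam) * sym_e_part N lam))"
proof -
  let ?d = "sum_mset mu"
  have mu: "0 \<notin># mu" using assms by (simp add: is_partition_def)
  let ?Q = "\<lambda>N a. sym_m N mu = (\<Sum>lam\<in>partitions_of ?d. of_int (a lam) * sym_e_part N lam)"
  have ex: "\<exists>a. (\<forall>lam. a lam \<noteq> 0 \<longrightarrow> lam \<in> partitions_of ?d \<and> set_mset lam \<subseteq> {0<..N}) \<and> ?Q N a" for N
    using symmetric_in_sym_e_span[OF symmetric_in_sym_m homog_sym_m] .
  obtain a where a: "\<And>lam. a lam \<noteq> 0 \<Longrightarrow> lam \<in> partitions_of ?d" "?Q ?d a"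
    using ex[of ?d] by blast
  have down: "?Q N a" if "?Q (Suc N) a" for N a
  proof -
    have "sym_m N mu = set_var_zero N (\<Sum>lam\<in>partitions_of ?d. of_int (a lam) * sym_e_part (Suc N) lam)"
      using that set_var_zero_sym_m[OF mu, of N] by simp
    then show ?thesis
      by (simp add: set_var_zero_sum set_var_zero_of_int_mult set_var_zero_sym_e_part)
  qed
  have "?Q N a" for N
  proof (cases "N \<le> ?d")
    case True
    then show ?thesis by (induction rule: inc_induct) (fact a(2), rule down)
  next
    case False
    then have "?d \<le> N" by simp
    then show ?thesis
    proof (induction rule: dec_induct)
      case (step N)
      obtain a' where a': "?Q (Suc N) a'" using ex by blast
      then have "?Q N a'" by (rule down)
      with step.IH have "(\<Sum>lam\<in>partitions_of ?d. of_int (a' lam - a lam) * sym_e_part N lam) = 0"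
        by (simp add: algebra_simps sum_subtractf)
      then have z: "of_int 0 dvd (\<Sum>lam\<in>partitions_of ?d. of_int (a' lam - a lam) * sym_e_part N lam)"
        by simp
      have "0 dvd a' lam - a lam" if "lam \<in> partitions_of ?d" for lam
      proof (rule sym_e_part_independent[OF finite_partitions_of _ z that])
        show "set_mset kap \<subseteq> {0<..N}" if "kap \<in> partitions_of ?d" for kap
          using partitions_of_parts that step.hyps(1) .
      qed
      then have "a' lam = a lam" if "lam \<in> partitions_of ?d" for lam
        using that by auto
      with a' show ?case by (simp cong: sum.cong)
    qed (rule a(2))
  qed
  with a(1) show ?thesis by blast
qed

text \<open>The transition matrix from monomial to elementary functions. It is needed for all
  partitions, since the second product of the generating identity involves every m_mu with parts
  below p.\<close>

definition m_to_e :: "partition \<Rightarrow> partition \<Rightarrow> int" where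
  "m_to_e mu = (SOME a. (\<forall>lam. a lam \<noteq> 0 \<longrightarrow> lam \<in> partitions_of (sum_mset mu)) \<and>
    (\<forall>N. sym_m N mu = (\<Sum>lam\<in>partitions_of (sum_mset mu). of_int (a lam) * sym_e_part N lam)))"

lemma m_to_e_spec:
  assumes "is_partition mu"
  shows m_to_e_support: "m_to_e mu lam \<noteq> 0 \<Longrightarrow> lam \<in> partitions_of (sum_mset mu)"
    and sym_m_eq: "sym_m N mu =
      (\<Sum>lam\<in>partitions_of (sum_mset mu). of_int (m_to_e mu lam) * sym_e_part N lam)"
  using someI_ex[OF sym_m_sym_e_span[OF assms], folded m_to_e_def] by blast+

lemma sym_e_part_eq_imp_eq:
  assumes "(\<Sum>lam\<in>partitions_of d. of_int (a lam) * sym_e_part d lam) =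
      (\<Sum>lam\<in>partitions_of d. of_int (b lam) * sym_e_part d lam)"
    and "lam \<in> partitions_of d"
  shows "a lam = b lam"
proof -
  have "(\<Sum>lam\<in>partitions_of d. of_int (a lam - b lam) * sym_e_part d lam) = 0"
    using assms(1) by (simp add: algebra_simps sum_subtractf)
  then have z: "of_int 0 dvd (\<Sum>lam\<in>partitions_of d. of_int (a lam - b lam) * sym_e_part d lam)"
    by simp
  have "0 dvd a lam - b lam"
    by (rule sym_e_part_independent[OF finite_partitions_of _ z assms(2)])
      (rule partitions_of_parts, auto)
  then show ?thesis by simp
qed

lemma is_partition_one_p: "p \<noteq> 0 \<Longrightarrow> is_partition (one_p_partition p n k)"
  by (auto simp: is_partition_def one_p_partition_def)

lemma sum_mset_one_p: "sum_mset (one_p_partition p n k) = p * n + k"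
  by (simp add: one_p_partition_def)

text \<open>Resolves the \<open>THE\<close>: existence is the fundamental theorem, uniqueness is
  independence in as many variables as the degree. A nonzero \<open>p\<close> keeps zero parts out
  of (1^k p^n).\<close>

lemma alpha_eq:
  assumes "p \<noteq> 0"
  shows "alpha p n k = m_to_e (one_p_partition p n k)"
  unfolding alpha_def
proof (rule the_equality)
  let ?mu = "one_p_partition p n k"
  note spec = m_to_e_spec[OF is_partition_one_p[OF assms, of n k], unfolded sum_mset_one_p]
  let ?P = "\<lambda>a. (\<forall>lam. lam \<notin> partitions_of (p * n + k) \<longrightarrow> a lam = 0) \<and>
     (\<forall>N. sym_m N ?mu = (\<Sum>lam\<in>partitions_of (p * n + k). of_int (a lam) * sym_e_part N lam))"
  show "?P (m_to_e ?mu)" using spec by blast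
  fix a assume a: "?P a"
  show "a = m_to_e ?mu"
  proof
    fix lam
    show "a lam = m_to_e ?mu lam"
    proof (cases "lam \<in> partitions_of (p * n + k)")
      case True
      show ?thesis
        by (rule sym_e_part_eq_imp_eq[OF _ True]) (use a spec(2) in metis)
    next
      case False
      then show ?thesis using a spec(1) by metis
    qed
  qed
qed

lemma sym_m_eq_0:
  assumes "N < size mu"
  shows "sym_m N mu = 0"
proof -
  have "size mu \<le> N" if "v \<in> monomials_of_type N mu" for v
    using that card_mono[of "{..<N}" "Poly_Mapping.keys v"] by (auto simp: monomials_of_type_def)
  then have "monomials_of_type N mu = {}" using assms by fastforce
  then show ?thesis by (simp add: sym_m_def)
qed

lemma le_largest_part: "r \<in># lam \<Longrightarrow> r \<le> largest_part lam"
  by (auto simp: largest_part_def)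

lemma largest_part_in: "lam \<noteq> {#} \<Longrightarrow> largest_part lam \<in># lam"
  by (simp add: largest_part_def)

text \<open>Take exactly \<open>largest_part lam\<close> variables. If \<open>mu\<close> had more
  parts, its monomial function would vanish there, while the e_kap with parts at most that number,
  \<open>lam\<close> among them, remain independent.\<close>

lemma m_to_e_size:
  assumes mu: "is_partition mu" and nz: "m_to_e mu lam \<noteq> 0"
  shows "size mu \<le> largest_part lam"
proof (rule ccontr)
  define N where "N = largest_part lam"
  assume "\<not> size mu \<le> largest_part lam"
  then have "0 = sym_m N mu" by (simp add: sym_m_eq_0 N_def)
  also have "\<dots> = (\<Sum>kap\<in>partitions_of (sum_mset mu). of_int (m_to_e mu kap) * sym_e_part N kap)"
    by (rule sym_m_eq[OF mu])
  also have "\<dots> = (\<Sum>kap\<in>{kap\<in>partitions_of (sum_mset mu). set_mset kap \<subseteq> {0<..N}}.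
      of_int (m_to_e mu kap) * sym_e_part N kap)"
  proof (rule sum.mono_neutral_right)
    show "\<forall>kap\<in>partitions_of (sum_mset mu) - {kap\<in>partitions_of (sum_mset mu). set_mset kap \<subseteq> {0<..N}}.
        of_int (m_to_e mu kap) * sym_e_part N kap = 0"
    proof
      fix kap assume "kap \<in> partitions_of (sum_mset mu) - {kap\<in>partitions_of (sum_mset mu). set_mset kap \<subseteq> {0<..N}}"
      then obtain r where "r \<in># kap" "\<not> r \<le> N" "0 \<notin># kap"
        by (fastforce simp: partitions_of_def is_partition_def)
      then show "of_int (m_to_e mu kap) * sym_e_part N kap = 0" by (simp add: sym_e_part_eq_0)
    qed
  qed (auto simp: finite_partitions_of)
  finally have z: "of_int 0 dvd (\<Sum>kap\<in>{kap\<in>partitions_of (sum_mset mu). set_mset kap \<subseteq> {0<..N}}.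
      of_int (m_to_e mu kap) * sym_e_part N kap)" by simp
  have lam: "lam \<in> partitions_of (sum_mset mu)" using m_to_e_support[OF mu nz] .
  moreover have "set_mset lam \<subseteq> {0<..N}"
    using partitions_of_parts[OF lam order_refl] le_largest_part[of _ lam] by (auto simp: N_def)
  ultimately have "0 dvd m_to_e mu lam"
    by (intro sym_e_part_independent[OF _ _ z]) (auto simp: finite_partitions_of)
  with nz show False by simp
qed

text \<open>In the recursion \<open>sym_m_Suc\<close> only the term with x_N to the power 1
  survives.\<close>

lemma linear_coeff_sym_m:
  assumes "0 \<notin># mu"
  shows "linear_coeff N (sym_m (Suc N) mu) = (if 1 \<in># mu then sym_m N (mu - {#1#}) else 0)"
proof -
  have z: "linear_coeff N (sym_m N nu) = 0" for nu
    unfolding sym_m_def linear_coeff_sum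
    by (intro sum.neutral ballI) (simp add: linear_coeff_def lookup_monomials_of_type)
  have "linear_coeff N (frag_of (Poly_Mapping.single N a) * sym_m N (mu - {#a#})) =
      (if a = 1 then sym_m N (mu - {#a#}) else 0)" if "a \<in># mu" for a
  proof -
    have "a \<noteq> 0" using that assms by metis
    moreover have "set_var_zero N (sym_m N (mu - {#a#})) = sym_m N (mu - {#a#})"
      using assms by (intro set_var_zero_sym_m_le) (auto dest: in_diffD)
    moreover have "linear_coeff N (frag_of (Poly_Mapping.single N a)) = (if a = 1 then 1 else 0)"
      unfolding linear_coeff_def by simp
    ultimately show ?thesis by (simp add: linear_coeff_mult z)
  qed
  then have "linear_coeff N (sym_m (Suc N) mu) =
      (\<Sum>a\<in>set_mset mu. if a = 1 then sym_m N (mu - {#a#}) else 0)"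
    using assms by (simp add: sym_m_Suc linear_coeff_add linear_coeff_sum z)
  then show ?thesis by simp
qed

section \<open>The Hammond operator\<close>

lemma H1_perp_add: "H1_perp (f + g) = H1_perp f + H1_perp g"
  and H1_perp_mult: "H1_perp (f * g) = H1_perp f * g + f * H1_perp g"
  using H1_perp_props(1) by (auto simp: derivation_def)

lemma H1_perp_zero [simp]: "H1_perp 0 = 0"
  using H1_perp_add[of 0 0] by simp

lemma H1_perp_one [simp]: "H1_perp 1 = 0"
  using H1_perp_mult[of 1 1] by simp

lemma H1_perp_uminus: "H1_perp (- f) = - H1_perp f"
  using H1_perp_add[of f "- f"] by (simp add: eq_neg_iff_add_eq_0 add.commute)

lemma H1_perp_diff: "H1_perp (f - g) = H1_perp f - H1_perp g"
  using H1_perp_add[of f "- g"] by (simp add: H1_perp_uminus)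

lemma H1_perp_sum: "H1_perp (\<Sum>i\<in>I. g i) = (\<Sum>i\<in>I. H1_perp (g i))"
  by (induction I rule: infinite_finite_induct) (simp_all add: H1_perp_add)

lemma H1_perp_of_int_mult: "H1_perp (of_int c * f) = of_int c * H1_perp f"
proof -
  have "H1_perp (of_nat n) = 0" for n by (induction n) (simp_all add: H1_perp_add)
  then have "H1_perp (of_int c) = 0" by (cases c rule: int_cases2) (simp_all add: H1_perp_uminus)
  then show ?thesis by (simp add: H1_perp_mult)
qed

lemma ex_0 [simp]: "ex 0 = 1" and ey_0 [simp]: "ey 0 = 1"
  by (simp_all add: ex_def ey_def)

lemma ex_part_empty [simp]: "ex_part {#} = 1"
  and ex_part_add_mset [simp]: "ex_part (add_mset r lam) = ex r * ex_part lam"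
  by (simp_all add: ex_part_def)

section \<open>Monomials in the generators and their evaluation at symmetric polynomials\<close>

definition xmono :: "partition \<Rightarrow> (nat + nat) \<Rightarrow>\<^sub>0 nat" where
  "xmono lam = (\<Sum>r\<in>#lam. case r of 0 \<Rightarrow> 0 | Suc i \<Rightarrow> Poly_Mapping.single (Inl i) 1)"

definition ymono :: "nat \<Rightarrow> (nat + nat) \<Rightarrow>\<^sub>0 nat" where
  "ymono j = (case j of 0 \<Rightarrow> 0 | Suc i \<Rightarrow> Poly_Mapping.single (Inr i) 1)"

lemma ex_part_frag_of: "ex_part lam = frag_of (xmono lam)"
proof (induction lam)
  case (add r lam)
  then show ?case by (cases r) (simp_all add: xmono_def ex_def mult_single)
qed (simp add: xmono_def)

lemma ey_frag_of: "ey j = frag_of (ymono j)"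
  by (cases j) (simp_all add: ymono_def ey_def)

lemma lookup_xmono: "Poly_Mapping.lookup (xmono lam) (Inl i) = count lam (Suc i)"
proof (induction lam)
  case (add r lam)
  then show ?case by (cases r) (auto simp: xmono_def lookup_add lookup_single when_def)
qed (simp add: xmono_def)

text \<open>The exponents of the e_n(x) record the multiplicities of all positive parts, so the
  factor in y cannot cause a collision.\<close>

lemma xmono_ymono_inject:
  assumes "xmono lam + ymono j = xmono lam' + ymono j'" "is_partition lam" "is_partition lam'"
  shows "lam = lam'"
proof (rule multiset_eqI)
  fix r
  have y: "Poly_Mapping.lookup (ymono j) (Inl i) = 0" for i j
    by (cases j) (simp_all add: ymono_def lookup_single when_def)
  have "Poly_Mapping.lookup (xmono lam + ymono j) (Inl i) =
      Poly_Mapping.lookup (xmono lam' + ymono j') (Inl i)" for i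
    using assms(1) by simp
  then have "count lam (Suc i) = count lam' (Suc i)" for i
    by (simp add: lookup_add y lookup_xmono)
  then show "count lam r = count lam' r"
    using assms(2,3) by (cases r) (simp_all add: is_partition_def not_in_iff)
qed

text \<open>Junk on monomials that involve some \<open>e\<^sub>n(y)\<close>: the value of \<open>THE\<close> is then unspecified.\<close>

definition e_eval :: "nat \<Rightarrow> epoly \<Rightarrow> xpoly" where
  "e_eval N = frag_extend (\<lambda>m. sym_e_part N (THE lam. is_partition lam \<and> xmono lam = m))"

lemma e_eval_add: "e_eval N (f + g) = e_eval N f + e_eval N g"
  and e_eval_diff: "e_eval N (f - g) = e_eval N f - e_eval N g"
  and e_eval_sum: "e_eval N (\<Sum>i\<in>I. h i) = (\<Sum>i\<in>I. e_eval N (h i))"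
  and e_eval_of_int_mult: "e_eval N (of_int c * f) = of_int c * e_eval N f"
  and e_eval_zero [simp]: "e_eval N 0 = 0"
  unfolding e_eval_def
  by (rule frag_extend_add frag_extend_diff frag_extend_sum' frag_extend_of_int_mult frag_extend_0)+

lemma e_eval_ex_part: "e_eval N (ex_part lam) = sym_e_part N lam"
proof -
  \<comment> \<open>Zero parts give a factor e_0 = 1 on both sides and are invisible to
    \<open>xmono\<close>; without them the \<open>THE\<close> in \<open>e_eval\<close> has a unique
    witness.\<close>
  define kap where "kap = filter_mset (\<lambda>r. r \<noteq> 0) lam"
  have kap: "is_partition kap" by (simp add: kap_def is_partition_def)
  have ex: "ex_part lam = ex_part kap" unfolding kap_def
    by (induction lam) auto
  have "e_eval N (ex_part kap) = sym_e_part N (THE lam. is_partition lam \<and> xmono lam = xmono kap)"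
    unfolding ex_part_frag_of e_eval_def by simp
  also have "(THE lam. is_partition lam \<and> xmono lam = xmono kap) = kap"
    using kap xmono_ymono_inject[of _ 0 _ 0] by (intro the_equality) auto
  also have "sym_e_part N kap = sym_e_part N lam"
    unfolding kap_def by (induction lam) auto
  finally show ?thesis using ex by simp
qed

text \<open>Evaluation carries \<open>H1_perp\<close> to \<open>linear_coeff\<close>. At hand is
  only linearity of \<open>e_eval\<close>, so \<open>kap\<close> accumulates the generators that the
  product rule leaves in front.\<close>

lemma e_eval_H1_perp_ex_part:
  assumes "is_partition lam"
  shows "e_eval N (ex_part kap * H1_perp (ex_part lam)) =
    sym_e_part N kap * linear_coeff N (sym_e_part (Suc N) lam)"
  using assms
proof (induction lam arbitrary: kap)
  case (add r lam)
  then obtain s where r: "r = Suc s" by (cases r) (auto simp: is_partition_def)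
  have lam: "is_partition lam" using add.prems by (simp add: is_partition_def)
  have ex_union: "ex_part (kap + lam) = ex_part kap * ex_part lam" by (simp add: ex_part_def)
  have e_union: "sym_e_part N (kap + lam) = sym_e_part N kap * sym_e_part N lam"
    by (simp add: sym_e_part_def)
  have "ex_part kap * H1_perp (ex_part (add_mset r lam)) =
      ex_part (add_mset s (kap + lam)) + ex_part (add_mset r kap) * H1_perp (ex_part lam)"
    using H1_perp_props(2)[of r] by (simp add: H1_perp_mult r ex_union algebra_simps)
  then show ?case
    using add.IH[OF lam, of "add_mset r kap"]
    by (simp add: e_eval_add e_eval_ex_part linear_coeff_mult r linear_coeff_sym_e
        set_var_zero_sym_e set_var_zero_sym_e_part e_union algebra_simps del: ex_part_add_mset)
qed simp

text \<open>The degree-m component of the subring generated by the e_n(x). There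
  \<open>e_eval N\<close> is meaningful, and it is injective as soon as N is at least m.\<close>

definition ex_span :: "nat \<Rightarrow> epoly set" where
  "ex_span m = {f. \<exists>c. f = (\<Sum>lam\<in>partitions_of m. of_int (c lam) * ex_part lam)}"

lemma ex_span_add:
  assumes "f \<in> ex_span m" "g \<in> ex_span m"
  shows "f + g \<in> ex_span m"
proof -
  obtain c d where "f = (\<Sum>lam\<in>partitions_of m. of_int (c lam) * ex_part lam)"
    "g = (\<Sum>lam\<in>partitions_of m. of_int (d lam) * ex_part lam)"
    using assms by (auto simp: ex_span_def)
  then have "f + g = (\<Sum>lam\<in>partitions_of m. of_int (c lam + d lam) * ex_part lam)"
    by (simp add: sum.distrib algebra_simps)
  then show ?thesis unfolding ex_span_def by (intro CollectI exI)
qed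

lemma ex_span_of_int_mult:
  assumes "f \<in> ex_span m"
  shows "of_int a * f \<in> ex_span m"
proof -
  obtain c where "f = (\<Sum>lam\<in>partitions_of m. of_int (c lam) * ex_part lam)"
    using assms by (auto simp: ex_span_def)
  then have "of_int a * f = (\<Sum>lam\<in>partitions_of m. of_int (a * c lam) * ex_part lam)"
    by (simp add: sum_distrib_left mult.assoc)
  then show ?thesis unfolding ex_span_def by (intro CollectI exI)
qed

lemma ex_span_zero: "0 \<in> ex_span m"
  unfolding ex_span_def by (intro CollectI exI[of _ "\<lambda>_. 0"]) simp

lemma ex_span_sum: "(\<And>i. i \<in> I \<Longrightarrow> g i \<in> ex_span m) \<Longrightarrow> (\<Sum>i\<in>I. g i) \<in> ex_span m"
  by (induction I rule: infinite_finite_induct) (simp_all add: ex_span_zero ex_span_add)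

lemma ex_span_diff: "f \<in> ex_span m \<Longrightarrow> g \<in> ex_span m \<Longrightarrow> f - g \<in> ex_span m"
  using ex_span_add[of f m "of_int (-1) * g"] ex_span_of_int_mult[of g m "-1"] by simp

lemma ex_part_in_ex_span: "ex_part lam \<in> ex_span (sum_mset lam)"
proof -
  define kap where "kap = filter_mset (\<lambda>r. r \<noteq> 0) lam"
  have ex: "ex_part lam = ex_part kap" unfolding kap_def by (induction lam) auto
  have sum: "sum_mset lam = sum_mset kap" unfolding kap_def by (induction lam) auto
  have "kap \<in> partitions_of (sum_mset kap)" by (simp add: kap_def partitions_of_def is_partition_def)
  then have "ex_part kap = (\<Sum>nu\<in>partitions_of (sum_mset kap). of_int (if nu = kap then 1 else 0) * ex_part nu)"
    by (simp add: if_distrib[of of_int] if_distrib[of "\<lambda>x. x * _"] finite_partitions_of cong: if_cong)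
  then show ?thesis unfolding ex sum ex_span_def by (intro CollectI exI)
qed

lemma H1_perp_ex_part_in_ex_span:
  assumes "is_partition lam"
  shows "ex_part kap * H1_perp (ex_part lam) \<in> ex_span (sum_mset kap + sum_mset lam - 1)"
  using assms
proof (induction lam arbitrary: kap)
  case (add r lam)
  then obtain s where r: "r = Suc s" by (cases r) (auto simp: is_partition_def)
  have lam: "is_partition lam" using add.prems by (simp add: is_partition_def)
  have ex_union: "ex_part (kap + lam) = ex_part kap * ex_part lam" by (simp add: ex_part_def)
  have "ex_part kap * H1_perp (ex_part (add_mset r lam)) =
      ex_part (add_mset s (kap + lam)) + ex_part (add_mset r kap) * H1_perp (ex_part lam)"
    using H1_perp_props(2)[of r] by (simp add: H1_perp_mult r ex_union algebra_simps)
  also have "\<dots> \<in> ex_span (sum_mset kap + sum_mset (add_mset r lam) - 1)"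
    using ex_part_in_ex_span[of "add_mset s (kap + lam)"] add.IH[OF lam, of "add_mset r kap"]
    by (intro ex_span_add) (simp_all add: r add_ac del: ex_part_add_mset)
  finally show ?case .
qed (simp add: ex_span_zero)

lemma e_eval_eq_0:
  assumes "f \<in> ex_span m" "m \<le> N" "e_eval N f = 0"
  shows "f = 0"
proof -
  obtain c where f: "f = (\<Sum>lam\<in>partitions_of m. of_int (c lam) * ex_part lam)"
    using assms by (auto simp: ex_span_def)
  have z: "of_int 0 dvd (\<Sum>lam\<in>partitions_of m. of_int (c lam) * sym_e_part N lam)"
    using assms(3) by (simp add: f e_eval_sum e_eval_of_int_mult e_eval_ex_part)
  have "0 dvd c lam" if "lam \<in> partitions_of m" for lam
    using that by (intro sym_e_part_independent[OF finite_partitions_of _ z])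
      (auto dest: partitions_of_parts[OF _ assms(2)])
  then show ?thesis by (simp add: f)
qed

text \<open>The symmetric function \<open>m\<^bsub>\<mu>\<^esub>(x)\<close> as an element of the polynomial ring in the \<open>e\<^sub>n(x)\<close>.\<close>

definition m_ex :: "partition \<Rightarrow> epoly" where
  "m_ex mu = (\<Sum>lam\<in>partitions_of (sum_mset mu). of_int (m_to_e mu lam) * ex_part lam)"

lemma m_ex_in_ex_span: "m_ex mu \<in> ex_span (sum_mset mu)"
  unfolding m_ex_def ex_span_def by blast

lemma e_eval_m_ex: "is_partition mu \<Longrightarrow> e_eval N (m_ex mu) = sym_m N mu"
  by (simp add: m_ex_def e_eval_sum e_eval_of_int_mult e_eval_ex_part sym_m_eq)

text \<open>With N = |mu|, both sides lie in \<open>ex_span (N - 1)\<close>, so it suffices to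
  compare them in N variables. There the left side is the coefficient of x_N in m_mu of N + 1
  variables.\<close>

lemma H1_perp_m_ex:
  assumes mu: "is_partition mu"
  shows "H1_perp (m_ex mu) = (if 1 \<in># mu then m_ex (mu - {#1#}) else 0)" (is "?L = ?R")
proof -
  define N where "N = sum_mset mu"
  have L: "?L = (\<Sum>lam\<in>partitions_of N. of_int (m_to_e mu lam) * H1_perp (ex_part lam))"
    by (simp add: m_ex_def H1_perp_sum H1_perp_of_int_mult N_def)
  have mu1: "is_partition (mu - {#1#})" using mu by (auto simp: is_partition_def dest: in_diffD)
  have "?L \<in> ex_span (N - 1)"
    unfolding L
  proof (intro ex_span_sum ex_span_of_int_mult)
    fix lam assume "lam \<in> partitions_of N"
    then show "H1_perp (ex_part lam) \<in> ex_span (N - 1)"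
      using H1_perp_ex_part_in_ex_span[of lam "{#}"] by (simp add: partitions_of_def)
  qed
  moreover have "?R \<in> ex_span (N - 1)"
  proof (cases "1 \<in># mu")
    case True
    then have "sum_mset (mu - {#1#}) = N - 1" unfolding N_def by (auto dest: multi_member_split)
    then show ?thesis using True m_ex_in_ex_span[of "mu - {#1#}"] by simp
  qed (simp add: ex_span_zero)
  ultimately have "?L - ?R \<in> ex_span (N - 1)" by (rule ex_span_diff)
  moreover have "e_eval N (?L - ?R) = 0"
  proof -
    have "e_eval N (H1_perp (ex_part lam)) = linear_coeff N (sym_e_part (Suc N) lam)"
      if "lam \<in> partitions_of N" for lam
      using that e_eval_H1_perp_ex_part[of lam N "{#}"] by (simp add: partitions_of_def)
    then have "e_eval N ?L = linear_coeff N
        (\<Sum>lam\<in>partitions_of N. of_int (m_to_e mu lam) * sym_e_part (Suc N) lam)"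
      unfolding L by (simp add: e_eval_sum e_eval_of_int_mult linear_coeff_sum linear_coeff_of_int_mult)
    also have "\<dots> = linear_coeff N (sym_m (Suc N) mu)"
      unfolding N_def sym_m_eq[OF mu] ..
    also have "\<dots> = e_eval N ?R"
      using mu mu1 by (simp add: linear_coeff_sym_m is_partition_def[of mu] e_eval_m_ex)
    finally show ?thesis by (simp add: e_eval_diff)
  qed
  ultimately have "?L - ?R = 0" by (intro e_eval_eq_0[of _ "N - 1" N]) auto
  then show ?thesis by simp
qed

section \<open>The coefficients beta\<close>

abbreviation partitions_upto :: "nat \<Rightarrow> partition set" where
  "partitions_upto d \<equiv> {lam. is_partition lam \<and> sum_mset lam \<le> d}"

definition exy_comb :: "nat \<Rightarrow> (partition \<Rightarrow> int) \<Rightarrow> epoly" where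
  "exy_comb d b = (\<Sum>lam\<in>partitions_upto d. of_int (b lam) * ex_part lam * ey (d - sum_mset lam))"

lemma lookup_exy_comb:
  assumes "lam \<in> partitions_upto d"
  shows "Poly_Mapping.lookup (exy_comb d b) (xmono lam + ymono (d - sum_mset lam)) = b lam"
proof -
  let ?m = "\<lambda>lam. xmono lam + ymono (d - sum_mset lam)"
  have "Poly_Mapping.lookup (exy_comb d b) (?m lam) =
      (\<Sum>kap\<in>partitions_upto d. b kap * Poly_Mapping.lookup (frag_of (?m kap)) (?m lam))"
    unfolding exy_comb_def lookup_sum
    by (intro sum.cong refl)
      (simp add: ex_part_frag_of ey_frag_of mult.assoc lookup_of_int_mult flip: frag_of_mult)
  also have "\<dots> = (\<Sum>kap\<in>partitions_upto d. if kap = lam then b kap else 0)"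
    using assms xmono_ymono_inject
    by (intro sum.cong refl) (auto simp: lookup_single when_def)
  also have "\<dots> = b lam" using assms finite_partitions_upto by simp
  finally show ?thesis .
qed

lemma exy_comb_dvd:
  assumes "of_int q dvd exy_comb d b - exy_comb d c" "lam \<in> partitions_upto d"
  shows "q dvd b lam - c lam"
proof -
  have "q dvd Poly_Mapping.lookup (exy_comb d b - exy_comb d c) (xmono lam + ymono (d - sum_mset lam))"
    using assms(1) unfolding of_int_dvd_iff_lookup by blast
  then show ?thesis using assms(2) by (simp add: lookup_minus lookup_exy_comb)
qed

lemma exy_comb_add: "exy_comb d b + exy_comb d c = exy_comb d (\<lambda>lam. b lam + c lam)"
  unfolding exy_comb_def by (simp add: sum.distrib algebra_simps)

lemma exy_comb_of_int_mult: "of_int a * exy_comb d b = exy_comb d (\<lambda>lam. a * b lam)"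
  unfolding exy_comb_def by (simp add: sum_distrib_left mult.assoc)

lemma range_exy_comb_add: "f \<in> range (exy_comb d) \<Longrightarrow> g \<in> range (exy_comb d) \<Longrightarrow> f + g \<in> range (exy_comb d)"
  by (auto simp: exy_comb_add)

lemma range_exy_comb_of_int_mult: "f \<in> range (exy_comb d) \<Longrightarrow> of_int a * f \<in> range (exy_comb d)"
  by (auto simp: exy_comb_of_int_mult)

lemma range_exy_comb_zero: "0 \<in> range (exy_comb d)"
  by (rule range_eqI[of _ _ "\<lambda>_. 0"]) (simp add: exy_comb_def)

lemma range_exy_comb_sum:
  "(\<And>i. i \<in> I \<Longrightarrow> g i \<in> range (exy_comb d)) \<Longrightarrow> (\<Sum>i\<in>I. g i) \<in> range (exy_comb d)"
  by (induction I rule: infinite_finite_induct) (simp_all add: range_exy_comb_zero range_exy_comb_add)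

lemma ex_span_mult_ey:
  assumes "f \<in> ex_span m" "d = m + j"
  shows "f * ey j \<in> range (exy_comb d)"
proof -
  have "ex_part lam * ey j \<in> range (exy_comb d)" if "lam \<in> partitions_of m" for lam
  proof (rule range_eqI)
    have "lam \<in> partitions_upto d" "d - sum_mset lam = j"
      using that assms(2) by (auto simp: partitions_of_def)
    then show "ex_part lam * ey j = exy_comb d (\<lambda>kap. if kap = lam then 1 else 0)"
      using finite_partitions_upto[of d]
      by (simp add: exy_comb_def if_distrib[of of_int] if_distrib[of "\<lambda>x. x * _"] cong: if_cong)
  qed
  moreover obtain c where "f = (\<Sum>lam\<in>partitions_of m. of_int (c lam) * ex_part lam)"
    using assms by (auto simp: ex_span_def)
  ultimately show ?thesis
    by (auto simp: sum_distrib_right mult.assoc intro!: range_exy_comb_sum range_exy_comb_of_int_mult)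
qed

text \<open>The product rule lowers either the part in x or the single factor in y; both outcomes
  keep the shape and reduce the total degree by one.\<close>

lemma H1_perp_range_exy_comb:
  assumes "f \<in> range (exy_comb d)"
  shows "H1_perp f \<in> range (exy_comb (d - 1))"
proof -
  have "H1_perp (ex_part lam * ey (d - sum_mset lam)) \<in> range (exy_comb (d - 1))"
    if lam: "lam \<in> partitions_upto d" for lam
  proof -
    define j where "j = d - sum_mset lam"
    have d: "d = sum_mset lam + j" using lam by (simp add: j_def)
    have "H1_perp (ex_part lam) * ey j \<in> range (exy_comb (d - 1))"
    proof (cases "lam = {#}")
      case False
      then have "sum_mset lam \<noteq> 0"
        using lam by (auto simp: is_partition_def sum_mset_0_iff)
          (metis gr0I multiset_nonemptyE)
      moreover have "H1_perp (ex_part lam) \<in> ex_span (sum_mset lam - 1)"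
        using H1_perp_ex_part_in_ex_span[of lam "{#}"] lam by simp
      ultimately show ?thesis using ex_span_mult_ey[of _ "sum_mset lam - 1" "d - 1" j]
        by (simp del: sum_mset_0_iff add: d)
    qed (simp add: range_exy_comb_zero)
    moreover have "ex_part lam * H1_perp (ey j) \<in> range (exy_comb (d - 1))"
    proof (cases j)
      case (Suc i)
      then have "H1_perp (ey j) = ey i" using H1_perp_props(3)[of j] by simp
      then show ?thesis
        using ex_span_mult_ey[OF ex_part_in_ex_span, of "d - 1" lam i] by (simp add: d Suc)
    qed (simp add: range_exy_comb_zero)
    ultimately show ?thesis unfolding j_def[symmetric] H1_perp_mult by (rule range_exy_comb_add)
  qed
  moreover obtain b where "f = (\<Sum>lam\<in>partitions_upto d. of_int (b lam) * (ex_part lam * ey (d - sum_mset lam)))"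
    using assms unfolding exy_comb_def mult.assoc by blast
  ultimately show ?thesis
    by (simp only: H1_perp_sum H1_perp_of_int_mult range_exy_comb_sum range_exy_comb_of_int_mult)
qed

lemma mbar_raw_in_range: "mbar_raw p n k \<in> range (exy_comb (p * n + k))"
  unfolding mbar_raw_def mult.assoc
proof (intro range_exy_comb_sum range_exy_comb_of_int_mult ex_span_mult_ey)
  fix lam assume "lam \<in> partitions_of (p * n + k)"
  then have "p * n + k = sum_mset lam" by (simp add: partitions_of_def)
  also have "\<dots> = sum_mset (lam - {#largest_part lam#}) + largest_part lam"
  proof (cases "lam = {#}")
    case False
    then obtain kap where "lam = add_mset (largest_part lam) kap"
      using largest_part_in by (metis insert_DiffM)
    then show ?thesis by (metis add.commute add_mset_remove_trivial sum_mset.add_mset)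
  qed (simp add: largest_part_def)
  finally show "p * n + k = sum_mset (lam - {#largest_part lam#}) + largest_part lam" .
qed (rule ex_part_in_ex_span)

lemma mbar_in_range:
  assumes "p \<ge> 2"
  shows "mbar p n k \<in> range (exy_comb (p * n + k))"
proof (cases "k \<ge> n * (p - 2)")
  case True
  then show ?thesis using mbar_raw_in_range by (simp add: mbar_def)
next
  case False
  have "(H1_perp ^^ j) (mbar_raw p n k') \<in> range (exy_comb (p * n + k' - j))" for j k'
  proof (induction j)
    case (Suc j)
    then show ?case using H1_perp_range_exy_comb by fastforce
  qed (simp add: mbar_raw_in_range)
  from this[of "n * (p - 2) - k" "n * (p - 2)"] show ?thesis
    using False by (simp add: mbar_def)
qed

lemma beta_spec:
  assumes "p \<ge> 2"
  shows "mbar p n k = exy_comb (p * n + k) (beta p n k)"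
    and "lam \<notin> partitions_upto (p * n + k) \<Longrightarrow> beta p n k lam = 0"
proof -
  let ?d = "p * n + k"
  let ?P = "\<lambda>b. (\<forall>lam. \<not> (is_partition lam \<and> sum_mset lam \<le> ?d) \<longrightarrow> b lam = 0) \<and>
     mbar p n k = (\<Sum>lam\<in>partitions_upto ?d. of_int (b lam) * ex_part lam * ey (?d - sum_mset lam))"
  obtain b where b: "mbar p n k = exy_comb ?d b" using mbar_in_range[OF assms] by blast
  \<comment> \<open>\<open>exy_comb\<close> ignores values outside its index set, but the defining
    property of \<open>beta\<close> requires zero there.\<close>
  define b' where "b' = (\<lambda>lam. if lam \<in> partitions_upto ?d then b lam else 0)"
  have "exy_comb ?d b = exy_comb ?d b'"
    unfolding exy_comb_def by (intro sum.cong) (auto simp: b'_def)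
  then have "?P b'" using b unfolding exy_comb_def by (auto simp: b'_def)
  moreover have "b1 = b2" if "?P b1" "?P b2" for b1 b2
  proof
    fix lam
    have "exy_comb ?d b1 = exy_comb ?d b2" using that unfolding exy_comb_def by metis
    then show "b1 lam = b2 lam"
      using lookup_exy_comb[of lam ?d b1] lookup_exy_comb[of lam ?d b2] that
      by (cases "lam \<in> partitions_upto ?d") auto
  qed
  ultimately have "\<exists>!b. ?P b" by (intro ex_ex1I) blast+
  then have "?P (beta p n k)" unfolding beta_def by (rule theI')
  then show "mbar p n k = exy_comb ?d (beta p n k)"
    "lam \<notin> partitions_upto ?d \<Longrightarrow> beta p n k lam = 0"
    unfolding exy_comb_def by blast+
qed

section \<open>Generating functions\<close>

definition degree_part :: "nat \<Rightarrow> xpoly \<Rightarrow> xpoly" where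
  "degree_part d = frag_extend (\<lambda>m. if mdeg m = d then frag_of m else 0)"

lemma degree_part_sum: "degree_part d (\<Sum>i\<in>I. g i) = (\<Sum>i\<in>I. degree_part d (g i))"
  unfolding degree_part_def by (rule frag_extend_sum')

lemma degree_part_homog: "homog e f \<Longrightarrow> degree_part d f = (if e = d then f else 0)"
  unfolding degree_part_def homog_def
  by (auto intro!: frag_extend_eq_0 trans[OF frag_extend_eq frag_expansion[symmetric]])

definition multisets_in :: "nat set \<Rightarrow> nat \<Rightarrow> partition set" where
  "multisets_in A n = {mu. set_mset mu \<subseteq> A \<and> size mu \<le> n}"

lemma finite_multisets_in:
  assumes "finite A"
  shows "finite (multisets_in A n)"
proof -
  have "multisets_in A n \<subseteq> mset ` {xs. set xs \<subseteq> A \<and> length xs \<le> n}"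
    unfolding multisets_in_def by (auto simp: image_iff) (metis ex_mset set_mset_mset size_mset)
  then show ?thesis by (rule finite_subset) (simp add: assms finite_lists_length_le)
qed

text \<open>Multiplying out, each variable receives an exponent from \<open>A\<close> or none. The
  weight of the resulting monomial depends only on its type, so equal types collect to a monomial
  symmetric polynomial.\<close>

lemma prod_eq_sum_sym_m:
  fixes c :: "nat \<Rightarrow> xpoly fps"
  assumes A: "finite A" "0 \<notin> A"
  shows "(\<Prod>j<N. 1 + (\<Sum>a\<in>A. c a * fps_const (frag_of (Poly_Mapping.single j a)))) =
    (\<Sum>mu\<in>multisets_in A N. (\<Prod>r\<in>#mu. c r) * fps_const (sym_m N mu))"
proof (induction N)
  case 0
  have "multisets_in A 0 = {{#}}" by (auto simp: multisets_in_def)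
  then show ?case by (simp add: sym_m_0)
next
  case (Suc N)
  let ?C = "\<lambda>mu :: partition. \<Prod>r\<in>#mu. c r"
  let ?x = "\<lambda>a. fps_const (frag_of (Poly_Mapping.single N a)) :: xpoly fps"
  let ?m = "\<lambda>mu. fps_const (sym_m N mu)"
  have fin: "finite (multisets_in A n)" for n by (rule finite_multisets_in[OF A(1)])
  have C: "?C mu = c a * ?C (mu - {#a#})" if "a \<in># mu" for a mu
    using that by (metis image_mset_add_mset insert_DiffM prod_mset.add_mset)
  have m: "fps_const (sym_m (Suc N) mu) = ?m mu + (\<Sum>a\<in>set_mset mu. ?x a * ?m (mu - {#a#}))"
    if "mu \<in> multisets_in A (Suc N)" for mu
  proof -
    have "fps_const (\<Sum>i\<in>I. g i) = (\<Sum>i\<in>I. fps_const (g i))" for g :: "nat \<Rightarrow> xpoly" and I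
      by (induction I rule: infinite_finite_induct) (simp_all flip: fps_const_add)
    moreover have "0 \<notin># mu" using that A by (auto simp: multisets_in_def)
    ultimately show ?thesis by (simp add: sym_m_Suc flip: fps_const_add)
  qed
  have "(\<Sum>mu\<in>multisets_in A (Suc N). ?C mu * fps_const (sym_m (Suc N) mu)) =
      (\<Sum>mu\<in>multisets_in A (Suc N). ?C mu * ?m mu) +
      (\<Sum>mu\<in>multisets_in A (Suc N). \<Sum>a\<in>set_mset mu. ?C mu * (?x a * ?m (mu - {#a#})))"
    by (simp add: m distrib_left sum.distrib sum_distrib_left cong: sum.cong)
  also have "(\<Sum>mu\<in>multisets_in A (Suc N). ?C mu * ?m mu) = (\<Sum>mu\<in>multisets_in A N. ?C mu * ?m mu)"
    by (rule sum.mono_neutral_right[OF fin]) (auto simp: multisets_in_def sym_m_eq_0)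
  also have "(\<Sum>mu\<in>multisets_in A (Suc N). \<Sum>a\<in>set_mset mu. ?C mu * (?x a * ?m (mu - {#a#}))) =
      (\<Sum>(mu, a)\<in>Sigma (multisets_in A (Suc N)) set_mset. ?C mu * (?x a * ?m (mu - {#a#})))"
    by (rule sum.Sigma) (auto simp: fin)
  \<comment> \<open>A multiset with a marked value \<open>a\<close> is the same as the value
    \<open>a\<close> together with the multiset left after removing it once.\<close>
  also have "\<dots> = (\<Sum>(nu, a)\<in>multisets_in A N \<times> A. ?C (add_mset a nu) * (?x a * ?m nu))"
    by (rule sum.reindex_bij_witness[of _ "\<lambda>(nu, a). (add_mset a nu, a)" "\<lambda>(mu, a). (mu - {#a#}, a)"])
      (auto simp: multisets_in_def C[symmetric] size_Diff_singleton dest: in_diffD)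
  also have "\<dots> = (\<Sum>nu\<in>multisets_in A N. \<Sum>a\<in>A. ?C (add_mset a nu) * (?x a * ?m nu))"
    by (rule sum.cartesian_product[symmetric])
  also have "\<dots> = (\<Sum>mu\<in>multisets_in A N. ?C mu * ?m mu) * (\<Sum>a\<in>A. c a * ?x a)"
    unfolding sum_product by (simp only: image_mset_add_mset prod_mset.add_mset mult_ac)
  finally show ?case using Suc.IH by (simp add: distrib_left)
qed

lemma prod_one_plus_xvar: "(\<Prod>j<N. 1 + xvar j) = (\<Sum>r\<le>N. sym_e N r)"
proof (induction N)
  case (Suc N)
  have "(\<Sum>r\<le>Suc N. sym_e (Suc N) r) = 1 + (\<Sum>r\<le>N. sym_e (Suc N) (Suc r))"
    by (subst sum.atMost_Suc_shift) simp
  also have "\<dots> = (1 + (\<Sum>r\<le>N. sym_e N (Suc r))) + xvar N * (\<Sum>r\<le>N. sym_e N r)"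
    by (simp add: sym_e_Suc_Suc sum.distrib sum_distrib_left)
  also have "1 + (\<Sum>r\<le>N. sym_e N (Suc r)) = (\<Sum>r\<le>Suc N. sym_e N r)"
    by (subst sum.atMost_Suc_shift) simp
  also have "\<dots> = (\<Sum>r\<le>N. sym_e N r)" by (simp add: sym_e_eq_0)
  finally show ?case using Suc.IH by (simp add: algebra_simps)
qed simp

text \<open>The alternating geometric sum telescopes: (1 + x) times the sum of (-x)^r over 0 < r < p
  is -x - (-x)^p.\<close>

lemma factor_identity:
  fixes x t :: "'a::comm_ring_1"
  assumes "p \<ge> 1"
  shows "(1 + x) * (1 + (\<Sum>r\<in>{1..<p}. t * (-1) ^ r * x ^ r)) =
    1 + ((1 - t) * x + - ((-1) ^ p) * t * x ^ p)"
proof -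
  have "(1 + x) * (\<Sum>r\<in>{1..<p}. t * (-1) ^ r * x ^ r) = - t * x - (-1) ^ p * t * x ^ p"
    using assms by (induction p rule: dec_induct) (simp_all add: algebra_simps)
  then show ?thesis by (simp add: distrib_left algebra_simps)
qed

text \<open>The coefficient of \<open>t\<^sup>m\<close> in \<open>(1 - t)\<^bsup>-k\<^esup>\<close>.\<close>

definition neg_binom :: "nat \<Rightarrow> nat \<Rightarrow> int" where
  "neg_binom k m = binom (int m + int k - 1) (int m)"

lemma neg_binom_0_right [simp]: "neg_binom k 0 = 1"
  by (simp add: neg_binom_def binom_def)

text \<open>Here the convention \<open>binom (-1) 0 = 1\<close> enters; it matches (1 - t)^0 =
  1.\<close>

lemma neg_binom_0_left: "neg_binom 0 m = (if m = 0 then 1 else 0)"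
  by (simp add: neg_binom_def binom_def)

lemma neg_binom_Suc_left: "neg_binom (Suc k) m = int (m + k choose m)"
  by (auto simp: neg_binom_def binom_def nat_add_distrib simp flip: of_nat_add)

lemma neg_binom_Suc_Suc: "neg_binom (Suc k) (Suc m) = neg_binom (Suc k) m + neg_binom k (Suc m)"
proof (cases k)
  case 0
  then show ?thesis by (simp add: neg_binom_Suc_left neg_binom_0_left)
next
  case (Suc j)
  then show ?thesis by (simp add: neg_binom_Suc_left del: binomial_Suc_Suc)
    (simp add: binomial_Suc_Suc)
qed

definition neg_binom_fps :: "nat \<Rightarrow> 'a::comm_ring_1 fps" where
  "neg_binom_fps k = Abs_fps (\<lambda>m. of_int (neg_binom k m))"

lemma neg_binom_fps_Suc: "neg_binom_fps (Suc k) * (1 - fps_X) = neg_binom_fps k"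
proof (rule fps_ext)
  fix m
  show "fps_nth (neg_binom_fps (Suc k) * (1 - fps_X)) m = fps_nth (neg_binom_fps k :: 'a fps) m"
    by (cases m) (simp_all add: neg_binom_fps_def algebra_simps neg_binom_Suc_Suc)
qed

lemma neg_binom_fps_mult: "neg_binom_fps k * (1 - fps_X) ^ k = 1"
proof (induction k)
  case 0
  show ?case by (rule fps_ext) (simp add: neg_binom_fps_def neg_binom_0_left)
next
  case (Suc k)
  have "neg_binom_fps (Suc k) * (1 - fps_X) ^ Suc k =
      (neg_binom_fps (Suc k) * (1 - fps_X)) * (1 - fps_X :: 'a fps) ^ k"
    by (simp only: power_Suc mult.assoc)
  then show ?case using Suc.IH by (simp only: neg_binom_fps_Suc)
qed

lemma fps_nth_one_minus_X_power:
  "fps_nth ((1 - fps_X :: 'a::comm_ring_1 fps) ^ m) l = of_int ((-1) ^ l * int (m choose l))"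
proof (induction m arbitrary: l)
  case (Suc m)
  have "(1 - fps_X :: 'a fps) ^ Suc m = (1 - fps_X) ^ m - fps_X * (1 - fps_X) ^ m"
    by (simp add: algebra_simps)
  then show ?case using Suc.IH by (cases l) (simp_all add: algebra_simps)
next
  case 0
  show ?case by (cases l) simp_all
qed

text \<open>Cancel l in the absorption identity l * binom(pl, l) = pl * binom(pl - 1, l -
  1).\<close>

lemma prime_dvd_binomial_mult:
  assumes "p > 0" "l > 0"
  shows "p dvd (p * l choose l)"
proof -
  obtain j where l: "l = Suc j" using assms by (cases l) auto
  then obtain i where i: "p * l = Suc i" using assms by (cases "p * l") auto
  have "l * (p * l choose l) = p * l * (i choose j)"
    unfolding i unfolding l by (rule Suc_times_binomial)
  then have "l * (p * l choose l) = l * (p * (i choose j))" by (simp only: mult_ac)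
  then show ?thesis using assms(2) by simp
qed

text \<open>\<open>fps_X\<close> plays the role of t. The left side expands the two products
  separately, the right side expands their merged factors, in which a part 1 has weight 1 - t and a
  part p has weight s t. No more than N parts fit into N variables, so all sums are finite.\<close>

lemma sym_e_mult_sym_m_fps:
  fixes N p :: nat
  assumes p: "p > 1"
  defines "s \<equiv> - ((-1) ^ p) :: int"
  shows "(\<Sum>r\<le>N. fps_const (sym_e N r)) *
      (\<Sum>mu\<in>multisets_in {1..<p} N. fps_X ^ size mu * of_int ((-1) ^ sum_mset mu) * fps_const (sym_m N mu)) =
    (\<Sum>(a, b)\<in>{(a, b). a + b \<le> N}. (1 - fps_X) ^ a * (of_int s * fps_X) ^ b *
      fps_const (sym_m N (one_p_partition p b a)))" (is "?E * ?M = ?R")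
proof -
  let ?x = "\<lambda>j. fps_const (xvar j) :: xpoly fps"
  have xpow: "fps_const (frag_of (Poly_Mapping.single j a)) = ?x j ^ a" for j a :: nat
  proof -
    have "frag_of (Poly_Mapping.single j a) = xvar j ^ a"
    proof (induction a)
      case (Suc a)
      have "frag_of (Poly_Mapping.single j (Suc a)) = xvar j * frag_of (Poly_Mapping.single j a)"
        unfolding xvar_def frag_of_mult[symmetric] by (simp flip: single_add)
      then show ?case using Suc.IH by simp
    qed simp
    then show ?thesis by (simp add: fps_const_power)
  qed
  have fsum: "fps_const (\<Sum>i\<in>I. g i) = (\<Sum>i\<in>I. fps_const (g i))" for g :: "nat \<Rightarrow> xpoly" and I
    by (induction I rule: infinite_finite_induct) (simp_all flip: fps_const_add)
  have fprod: "fps_const (\<Prod>i\<in>I. g i) = (\<Prod>i\<in>I. fps_const (g i))" for g :: "nat \<Rightarrow> xpoly" and I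
    by (induction I rule: infinite_finite_induct) (simp_all flip: fps_const_mult)
  have "?E = fps_const (\<Prod>j<N. 1 + xvar j)" by (simp add: prod_one_plus_xvar fsum)
  then have E: "?E = (\<Prod>j<N. 1 + ?x j)" by (simp add: fprod flip: fps_const_add)
  have c1: "(\<Prod>r\<in>#mu. fps_X * (-1) ^ r) = fps_X ^ size mu * (of_int ((-1) ^ sum_mset mu) :: xpoly fps)" for mu
    by (induction mu) (simp_all add: power_add mult_ac)
  have M: "?M = (\<Prod>j<N. 1 + (\<Sum>a\<in>{1..<p}. fps_X * (-1) ^ a * ?x j ^ a))"
    using prod_eq_sum_sym_m[of "{1..<p}" "\<lambda>r. fps_X * (-1) ^ r" N] by (simp add: c1 xpow)
  define c where "c = (\<lambda>a :: nat. if a = 1 then 1 - fps_X else of_int s * fps_X :: xpoly fps)"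
  have "?E * ?M = (\<Prod>j<N. 1 + ((1 - fps_X) * ?x j + - ((-1) ^ p) * fps_X * ?x j ^ p))"
    unfolding E M prod.distrib[symmetric] by (intro prod.cong refl factor_identity) (use p in simp)
  also have "\<dots> = (\<Prod>j<N. 1 + (\<Sum>a\<in>{1, p}. c a * fps_const (frag_of (Poly_Mapping.single j a))))"
    using p by (simp add: c_def xpow s_def)
  also have "\<dots> = (\<Sum>mu\<in>multisets_in {1, p} N. (\<Prod>r\<in>#mu. c r) * fps_const (sym_m N mu))"
    by (rule prod_eq_sum_sym_m) (use p in auto)
  also have "\<dots> = (\<Sum>(a, b)\<in>{(a, b). a + b \<le> N}. (\<Prod>r\<in>#one_p_partition p b a. c r) *
      fps_const (sym_m N (one_p_partition p b a)))"
  proof -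
    let ?f = "\<lambda>(a, b). one_p_partition p b a"
    let ?I = "{(a, b). a + b \<le> N}"
    \<comment> \<open>As p > 1, the parts 1 and p differ, so \<open>a\<close> and \<open>b\<close>
      are their multiplicities.\<close>
    have inj: "inj_on ?f ?I"
    proof (rule inj_onI, clarify)
      fix a b a' b' assume eq: "one_p_partition p b a = one_p_partition p b' a'"
      have "count (one_p_partition p b a) 1 = a" "count (one_p_partition p b a) p = b" for a b :: nat
        using p by (simp_all add: one_p_partition_def)
      then show "a = a' \<and> b = b'" using eq by metis
    qed
    have "multisets_in {1, p} N = ?f ` ?I"
    proof (intro equalityI subsetI)
      fix mu assume mu: "mu \<in> multisets_in {1, p} N"
      have eq: "mu = one_p_partition p (count mu p) (count mu 1)"
      proof (rule multiset_eqI)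
        fix x
        show "count mu x = count (one_p_partition p (count mu p) (count mu 1)) x"
          using mu p by (cases "x \<in># mu") (auto simp: multisets_in_def one_p_partition_def not_in_iff)
      qed
      then have "size mu = count mu 1 + count mu p"
        by (metis one_p_partition_def size_replicate_mset size_union)
      then have "(count mu 1, count mu p) \<in> ?I" using mu by (simp add: multisets_in_def)
      with eq show "mu \<in> ?f ` ?I" by force
    qed (auto simp: multisets_in_def one_p_partition_def split: if_splits)
    then show ?thesis by (simp only: sum.reindex[OF inj]) (auto intro: sum.cong)
  qed
  also have "\<dots> = ?R"
    using p by (intro sum.cong refl) (auto simp: one_p_partition_def c_def)
  finally show ?thesis .
qed

text \<open>Disposes of the sign of the x^p term: it is 1 for odd p, and signs do not matter modulo
  2.\<close>

lemma dvd_prime_sign: "prime p \<Longrightarrow> int p dvd 1 - (- ((-1) ^ p)) ^ n"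
proof -
  assume p: "prime p"
  show ?thesis
  proof (cases "p = 2")
    case False
    then have "odd p" using p prime_odd_nat[of p] prime_ge_2_nat[of p] by auto
    then show ?thesis by simp
  next
    case True
    have "even (1 - (- 1) ^ n :: int)" by simp
    then show ?thesis using True by simp
  qed
qed

text \<open>The coefficient of t^n m_mu in (1 - t)^(-k) times the second product of the generating
  identity: every part r contributes t (-1)^r, and the remaining power of t comes from (1 -
  t)^(-k).\<close>

definition m_weight :: "nat \<Rightarrow> nat \<Rightarrow> partition \<Rightarrow> int" where
  "m_weight n k mu = (if size mu \<le> n then neg_binom k (n - size mu) * (-1) ^ sum_mset mu else 0)"

text \<open>Taking the coefficient of \<open>t\<^sup>n\<close> in degree \<open>d = pn+k\<close> of \<open>(1 - t)\<^bsup>-k\<^esup>\<close> times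
  the previous identity, the right-hand side becomes a sum over \<open>b \<le> n\<close> of
  \<open>m\<^bsub>(1\<^sup>a p\<^sup>b)\<^esub>\<close> with \<open>a = k + p(n - b)\<close>, weighted by the coefficient of \<open>t\<^bsup>n-b\<^esup>\<close>
  in \<open>(1 - t)\<^bsup>p(n-b)\<^esup>\<close>; this is divisible by \<open>p\<close> unless \<open>b = n\<close>.\<close>

lemma sym_m_one_p_congruence:
  fixes N p n k :: nat
  assumes p: "prime p"
  defines "d \<equiv> p * n + k"
  assumes N: "d \<le> N"
  shows "of_int (int p) dvd sym_m N (one_p_partition p n k) -
    (\<Sum>mu\<in>multisets_in {1..<p} n. of_int (m_weight n k mu) *
      (sym_e N (d - sum_mset mu) * sym_m N mu))"
proof -
  define s :: int where "s = - ((-1) ^ p)"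
  have p1: "p > 1" using p by (rule prime_gt_1_nat)
  have nd: "n \<le> d" using p1 by (simp add: d_def trans_le_add1)
  let ?H = "neg_binom_fps k :: xpoly fps"
  let ?c = "\<lambda>f. degree_part d (fps_nth (?H * f) n)"
  have csum: "?c (\<Sum>i\<in>I. g i) = (\<Sum>i\<in>I. ?c (g i))" for I and g :: "'b \<Rightarrow> xpoly fps"
    by (simp add: sum_distrib_left fps_sum_nth degree_part_sum)
  have oi: "(of_int a :: xpoly fps) = fps_const (of_int a)" for a
    by (simp add: fps_of_int)
  have size_le: "sum_mset mu \<le> (p - 1) * size mu" if "set_mset mu \<subseteq> {1..<p}" for mu
    using that by (induction mu) auto
  have sum_le: "sum_mset mu \<le> d" if mu: "mu \<in> multisets_in {1..<p} n" for mu
  proof -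
    have "sum_mset mu \<le> (p - 1) * size mu" using mu size_le by (simp add: multisets_in_def)
    also have "\<dots> \<le> p * n" using mu by (intro mult_le_mono) (auto simp: multisets_in_def)
    finally show ?thesis by (simp add: d_def)
  qed
  have L: "?c (fps_const (sym_e N r) *
        (fps_X ^ size mu * of_int ((-1) ^ sum_mset mu) * fps_const (sym_m N mu))) =
      (if r + sum_mset mu = d then of_int (m_weight n k mu) * (sym_e N r * sym_m N mu) else 0)" for r mu
  proof -
    have "fps_nth (?H * (fps_const (sym_e N r) *
        (fps_X ^ size mu * of_int ((-1) ^ sum_mset mu) * fps_const (sym_m N mu)))) n =
      fps_nth (fps_const (of_int ((-1) ^ sum_mset mu) * (sym_e N r * sym_m N mu)) * (fps_X ^ size mu * ?H)) n"
      by (simp only: oi fps_const_mult[symmetric] mult_ac)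
    also have "\<dots> = of_int ((-1) ^ sum_mset mu) * (sym_e N r * sym_m N mu) *
        (if n < size mu then 0 else of_int (neg_binom k (n - size mu)))"
      by (simp only: fps_mult_left_const_nth fps_X_power_mult_nth neg_binom_fps_def Abs_fps_inverse) simp
    also have "\<dots> = of_int (m_weight n k mu) * (sym_e N r * sym_m N mu)"
      by (simp add: m_weight_def mult_ac)
    finally show ?thesis
      by (simp only: degree_part_homog[OF homog_of_int_mult[OF homog_mult[OF homog_sym_e homog_sym_m]]])
  qed
  have "?c ((\<Sum>r\<le>N. fps_const (sym_e N r)) *
      (\<Sum>mu\<in>multisets_in {1..<p} N. fps_X ^ size mu * of_int ((-1) ^ sum_mset mu) * fps_const (sym_m N mu))) =
    (\<Sum>mu\<in>multisets_in {1..<p} N. \<Sum>r\<le>N. if r + sum_mset mu = d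
      then of_int (m_weight n k mu) * (sym_e N r * sym_m N mu) else 0)"
    unfolding sum_product csum L by (rule sum.swap)
  also have "\<dots> = (\<Sum>mu\<in>multisets_in {1..<p} n. \<Sum>r\<le>N. if r + sum_mset mu = d
      then of_int (m_weight n k mu) * (sym_e N r * sym_m N mu) else 0)"
  proof (rule sum.mono_neutral_right[OF finite_multisets_in])
    show "multisets_in {1..<p} n \<subseteq> multisets_in {1..<p} N"
      using nd N by (auto simp: multisets_in_def)
    have "m_weight n k mu = 0" if "mu \<in> multisets_in {1..<p} N - multisets_in {1..<p} n" for mu
      using that by (auto simp: multisets_in_def m_weight_def)
    then show "\<forall>mu\<in>multisets_in {1..<p} N - multisets_in {1..<p} n. (\<Sum>r\<le>N. if r + sum_mset mu = d
      then of_int (m_weight n k mu) * (sym_e N r * sym_m N mu) else 0) = 0"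
      by (intro ballI) (simp only: of_int_0 mult_zero_left if_cancel sum.neutral_const)
  qed simp
  also have "\<dots> = (\<Sum>mu\<in>multisets_in {1..<p} n. of_int (m_weight n k mu) *
      (sym_e N (d - sum_mset mu) * sym_m N mu))"
  proof (rule sum.cong[OF refl])
    fix mu assume "mu \<in> multisets_in {1..<p} n"
    then have "r + sum_mset mu = d \<longleftrightarrow> r = d - sum_mset mu" for r
      using sum_le[of mu] by auto
    moreover have "d - sum_mset mu \<in> {..N}" using N by auto
    ultimately show "(\<Sum>r\<le>N. if r + sum_mset mu = d
      then of_int (m_weight n k mu) * (sym_e N r * sym_m N mu) else 0) =
      of_int (m_weight n k mu) * (sym_e N (d - sum_mset mu) * sym_m N mu)"
      by (simp only: sum.delta[OF finite_atMost] if_True)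
  qed
  finally have lhs: "?c ((\<Sum>r\<le>N. fps_const (sym_e N r)) *
      (\<Sum>mu\<in>multisets_in {1..<p} N. fps_X ^ size mu * of_int ((-1) ^ sum_mset mu) * fps_const (sym_m N mu))) =
    (\<Sum>mu\<in>multisets_in {1..<p} n. of_int (m_weight n k mu) *
      (sym_e N (d - sum_mset mu) * sym_m N mu))" .
  let ?I = "{(a, b). a + b \<le> N}"
  let ?t = "\<lambda>a b. (1 - fps_X) ^ a * (of_int s * fps_X) ^ b * fps_const (sym_m N (one_p_partition p b a))"
  have tt: "?H * ?t a b = fps_const (of_int (s ^ b) * sym_m N (one_p_partition p b a)) *
      (fps_X ^ b * (?H * (1 - fps_X) ^ a))" for a b
    by (simp only: power_mult_distrib mult_ac oi fps_const_mult[symmetric] of_int_power fps_const_power)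
  have R: "of_int (int p) dvd ?c (?t a b) - (if a = k \<and> b = n then of_int (s ^ n) * sym_m N (one_p_partition p n k) else 0)"
    for a b
  proof (cases "b \<le> n \<and> p * b + a = d")
    case False
    \<comment> \<open>Either t^b overshoots t^n, or the term has a degree other than
      \<open>d\<close>. In the latter case it is enough that the coefficient is an integer, so that
      the term is homogeneous and \<open>degree_part\<close> removes it.\<close>
    have "\<exists>c. fps_nth (?H * (1 - fps_X) ^ a) m = of_int c" for m
      unfolding fps_mult_nth neg_binom_fps_def fps_nth_one_minus_X_power fps_nth_Abs_fps
      by (simp flip: of_int_mult of_int_sum)
    then obtain c' where c': "fps_nth (?H * (1 - fps_X) ^ a) (n - b) = of_int c'" by blast
    define c where "c = (if n < b then 0 else s ^ b * c')"
    have c: "fps_nth (?H * ?t a b) n = of_int c * sym_m N (one_p_partition p b a)" "n < b \<longrightarrow> c = 0"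
      unfolding tt fps_mult_left_const_nth fps_X_power_mult_nth c' c_def by (simp_all add: mult_ac)
    have "?c (?t a b) = 0"
      unfolding c(1) degree_part_homog[OF homog_of_int_mult[OF homog_sym_m]] sum_mset_one_p
      using False c(2) by auto
    moreover have "\<not> (a = k \<and> b = n)" using False by (auto simp: d_def)
    ultimately show ?thesis by (simp only: if_False diff_zero dvd_0_right)
  next
    case True
    define l where "l = n - b"
    have n: "n = b + l" using True by (simp add: l_def)
    have a: "a = k + p * l" using True by (simp add: d_def n algebra_simps)
    have "?H * (1 - fps_X) ^ a = (?H * (1 - fps_X) ^ k) * (1 - fps_X) ^ (p * l)"
      by (simp only: a power_add mult.assoc)
    also have "\<dots> = (1 - fps_X) ^ (p * l)" by (simp only: neg_binom_fps_mult mult_1_left)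
    finally have "?H * ?t a b = fps_const (of_int (s ^ b) * sym_m N (one_p_partition p b a)) * (fps_X ^ b * (1 - fps_X) ^ (p * l))"
      by (simp only: tt)
    then have "fps_nth (?H * ?t a b) n = of_int (s ^ b) * sym_m N (one_p_partition p b a) *
        of_int ((-1) ^ l * int (p * l choose l))"
      unfolding n by (simp only: fps_mult_left_const_nth fps_X_power_mult_nth fps_nth_one_minus_X_power) simp
    then have nth: "fps_nth (?H * ?t a b) n =
        of_int (s ^ b * ((-1) ^ l * int (p * l choose l))) * sym_m N (one_p_partition p b a)"
      by (simp add: mult_ac)
    have ct: "?c (?t a b) = of_int (s ^ b * ((-1) ^ l * int (p * l choose l))) * sym_m N (one_p_partition p b a)"
      unfolding nth degree_part_homog[OF homog_of_int_mult[OF homog_sym_m]] sum_mset_one_p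
      using True by simp
    show ?thesis
    proof (cases "l = 0")
      case True
      then show ?thesis unfolding ct by (simp add: n a)
    next
      case False
      then have "int p dvd int (p * l choose l)"
        using p1 by (intro int_dvd_int_iff[THEN iffD2] prime_dvd_binomial_mult) auto
      then have "of_int (int p) dvd ?c (?t a b)"
        unfolding ct by (intro dvd_mult2 of_int_dvd_of_int_frag[THEN iffD2] dvd_mult)
      then show ?thesis using False by (simp add: n)
    qed
  qed
  have fin: "finite ?I" by (rule finite_subset[of _ "{..N} \<times> {..N}"]) auto
  have kn: "(k, n) \<in> ?I"
  proof -
    have "n \<le> p * n" using p1 by simp
    then have "k + n \<le> N" using N unfolding d_def by linarith
    then show ?thesis by simp
  qed
  have "of_int (int p) dvd (\<Sum>(a, b)\<in>?I. ?c (?t a b) -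
      (if a = k \<and> b = n then of_int (s ^ n) * sym_m N (one_p_partition p n k) else 0))"
    using R by (intro dvd_sum) auto
  also have "(\<Sum>(a, b)\<in>?I. ?c (?t a b) -
      (if a = k \<and> b = n then of_int (s ^ n) * sym_m N (one_p_partition p n k) else 0)) =
      ?c (\<Sum>(a, b)\<in>?I. ?t a b) - of_int (s ^ n) * sym_m N (one_p_partition p n k)"
  proof -
    have "(\<Sum>(a, b)\<in>?I. if a = k \<and> b = n then of_int (s ^ n) * sym_m N (one_p_partition p n k) else 0) =
        (\<Sum>i\<in>?I. if i = (k, n) then of_int (s ^ n) * sym_m N (one_p_partition p n k) else 0)"
      by (intro sum.cong refl) (simp only: split_def prod_eq_iff fst_conv snd_conv)
    also have "\<dots> = of_int (s ^ n) * sym_m N (one_p_partition p n k)"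
      using fin kn by (simp only: sum.delta if_True)
    finally show ?thesis by (simp only: csum split_def sum_subtractf)
  qed
  also have "(\<Sum>(a, b)\<in>?I. ?t a b) = (\<Sum>r\<le>N. fps_const (sym_e N r)) *
      (\<Sum>mu\<in>multisets_in {1..<p} N. fps_X ^ size mu * of_int ((-1) ^ sum_mset mu) * fps_const (sym_m N mu))"
    unfolding s_def by (rule sym_e_mult_sym_m_fps[OF p1, symmetric])
  finally have 1: "of_int (int p) dvd (\<Sum>mu\<in>multisets_in {1..<p} n. of_int (m_weight n k mu) *
      (sym_e N (d - sum_mset mu) * sym_m N mu)) - of_int (s ^ n) * sym_m N (one_p_partition p n k)" (is "_ dvd ?X - _")
    unfolding lhs .
  have "of_int (int p) dvd of_int (1 - s ^ n) * sym_m N (one_p_partition p n k)"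
    unfolding s_def by (intro dvd_mult2 of_int_dvd_of_int_frag[THEN iffD2] dvd_prime_sign p)
  from dvd_diff[OF this 1]
  have "of_int (int p) dvd sym_m N (one_p_partition p n k) - ?X"
    by (simp add: algebra_simps)
  then show ?thesis .
qed

section \<open>The coefficients modulo p\<close>

text \<open>The coefficient of \<open>t\<^sup>n e\<^bsub>\<lambda>\<^esub>\<close> in \<open>(1 - t)\<^bsup>-k\<^esup> \<Prod>\<^sub>j (1 + t \<Sum>\<^bsub>0<r<p\<^esub> (-x\<^sub>j)\<^sup>r)\<close>.\<close>

definition h_coeff :: "nat \<Rightarrow> nat \<Rightarrow> nat \<Rightarrow> partition \<Rightarrow> int" where
  "h_coeff p n k lam = (\<Sum>mu\<in>multisets_in {1..<p} n. m_weight n k mu * m_to_e mu lam)"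

lemma is_partition_multisets_in: "mu \<in> multisets_in {1..<p} n \<Longrightarrow> is_partition mu"
  by (auto simp: multisets_in_def is_partition_def)

lemma sum_mset_multisets_in:
  assumes "mu \<in> multisets_in {1..<p} n"
  shows "sum_mset mu \<le> (p - 1) * size mu" "sum_mset mu \<le> (p - 1) * n"
proof -
  have "sum_mset mu \<le> (p - 1) * size mu" if "set_mset mu \<subseteq> {1..<p}" for mu
    using that by (induction mu) auto
  then show 1: "sum_mset mu \<le> (p - 1) * size mu" using assms by (simp add: multisets_in_def)
  also have "\<dots> \<le> (p - 1) * n" using assms by (simp add: multisets_in_def)
  finally show "sum_mset mu \<le> (p - 1) * n" .
qed

lemma h_coeff_support:
  assumes "h_coeff p n k lam \<noteq> 0"
  shows "is_partition lam" "sum_mset lam \<le> (p - 1) * n"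
proof -
  obtain mu where "mu \<in> multisets_in {1..<p} n" "m_weight n k mu * m_to_e mu lam \<noteq> 0"
    using assms unfolding h_coeff_def by (rule sum.not_neutral_contains_not_neutral)
  then have mu: "mu \<in> multisets_in {1..<p} n" "m_to_e mu lam \<noteq> 0" by auto
  then have "lam \<in> partitions_of (sum_mset mu)"
    by (intro m_to_e_support is_partition_multisets_in)
  then show "is_partition lam" "sum_mset lam \<le> (p - 1) * n"
    using sum_mset_multisets_in(2)[OF mu(1)] by (auto simp: partitions_of_def)
qed

text \<open>\<open>G\<close> stays arbitrary because the same interchange of sums is used for
  symmetric polynomials and for the ring in two alphabets.\<close>

lemma sum_m_weight_eq_sum_h_coeff:
  fixes G :: "partition \<Rightarrow> 'a::comm_ring_1"
  assumes d: "(p - 1) * n \<le> d"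
  shows "(\<Sum>mu\<in>multisets_in {1..<p} n. of_int (m_weight n k mu) *
      (\<Sum>lam\<in>partitions_of (sum_mset mu). of_int (m_to_e mu lam) * G lam)) =
    (\<Sum>lam\<in>partitions_upto d. of_int (h_coeff p n k lam) * G lam)"
proof -
  have "(\<Sum>lam\<in>partitions_of (sum_mset mu). of_int (m_to_e mu lam) * G lam) =
      (\<Sum>lam\<in>partitions_upto d. of_int (m_to_e mu lam) * G lam)"
    if mu: "mu \<in> multisets_in {1..<p} n" for mu
  proof (rule sum.mono_neutral_left[OF finite_partitions_upto])
    show "partitions_of (sum_mset mu) \<subseteq> partitions_upto d"
      using sum_mset_multisets_in(2)[OF mu] d by (auto simp: partitions_of_def)
    show "\<forall>lam\<in>partitions_upto d - partitions_of (sum_mset mu). of_int (m_to_e mu lam) * G lam = 0"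
      by (metis DiffD2 is_partition_multisets_in[OF mu] m_to_e_support mult_zero_left of_int_0)
  qed
  then have "(\<Sum>mu\<in>multisets_in {1..<p} n. of_int (m_weight n k mu) *
      (\<Sum>lam\<in>partitions_of (sum_mset mu). of_int (m_to_e mu lam) * G lam)) =
    (\<Sum>mu\<in>multisets_in {1..<p} n. \<Sum>lam\<in>partitions_upto d.
      of_int (m_weight n k mu) * (of_int (m_to_e mu lam) * G lam))"
    by (simp add: sum_distrib_left)
  also have "\<dots> = (\<Sum>lam\<in>partitions_upto d. \<Sum>mu\<in>multisets_in {1..<p} n.
      of_int (m_weight n k mu) * (of_int (m_to_e mu lam) * G lam))"
    by (rule sum.swap)
  finally show ?thesis by (simp add: h_coeff_def sum_distrib_right mult.assoc)
qed

text \<open>Multiplication by \<open>e\<^bsub>d-|\<lambda>|\<^esub>\<close>, where \<open>e\<^sub>0 = 1\<close> contributes no part.\<close>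

definition complete_to :: "nat \<Rightarrow> partition \<Rightarrow> partition" where
  "complete_to d lam = (if sum_mset lam = d then lam else add_mset (d - sum_mset lam) lam)"

lemma complete_to_in: "lam \<in> partitions_upto d \<Longrightarrow> complete_to d lam \<in> partitions_of d"
  by (auto simp: complete_to_def partitions_of_def is_partition_def)

lemma sym_e_part_complete_to:
  "lam \<in> partitions_upto d \<Longrightarrow>
    sym_e_part N (complete_to d lam) = sym_e N (d - sum_mset lam) * sym_e_part N lam"
  by (auto simp: complete_to_def)

text \<open>Compare coefficients of e_mu modulo p in as many variables as the degree. Different
  \<open>lam\<close> can complete to the same \<open>mu\<close>, hence the sum over a fibre.\<close>

lemma alpha_congruence:
  assumes p: "prime p" and mu: "mu \<in> partitions_of (p * n + k)"
  shows "int p dvd alpha p n k mu -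
    (\<Sum>lam\<in>{lam \<in> partitions_upto (p * n + k). complete_to (p * n + k) lam = mu}. h_coeff p n k lam)"
proof -
  define d where "d = p * n + k"
  have p0: "p \<noteq> 0" using p by auto
  have d: "(p - 1) * n \<le> d" by (simp add: d_def trans_le_add1)
  let ?g = "\<lambda>mu. \<Sum>lam\<in>{lam \<in> partitions_upto d. complete_to d lam = mu}. h_coeff p n k lam"
  have "(\<Sum>mu\<in>multisets_in {1..<p} n. of_int (m_weight n k mu) * (sym_e d (d - sum_mset mu) * sym_m d mu)) =
     (\<Sum>mu\<in>multisets_in {1..<p} n. of_int (m_weight n k mu) *
      (\<Sum>lam\<in>partitions_of (sum_mset mu). of_int (m_to_e mu lam) * (sym_e d (d - sum_mset lam) * sym_e_part d lam)))"
    by (intro sum.cong refl arg_cong2[where f = "(*)"])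
      (simp add: sym_m_eq is_partition_multisets_in sum_distrib_left mult_ac partitions_of_def)
  also have "\<dots> = (\<Sum>lam\<in>partitions_upto d. of_int (h_coeff p n k lam) * (sym_e d (d - sum_mset lam) * sym_e_part d lam))"
    by (rule sum_m_weight_eq_sum_h_coeff[OF d])
  also have "\<dots> = (\<Sum>lam\<in>partitions_upto d. of_int (h_coeff p n k lam) * sym_e_part d (complete_to d lam))"
    by (intro sum.cong refl) (simp add: sym_e_part_complete_to)
  also have "\<dots> = (\<Sum>mu\<in>partitions_of d. \<Sum>lam\<in>{lam \<in> partitions_upto d. complete_to d lam = mu}.
      of_int (h_coeff p n k lam) * sym_e_part d (complete_to d lam))"
    by (rule sum.group[symmetric]) (use finite_partitions_upto finite_partitions_of complete_to_in in blast)+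
  also have "\<dots> = (\<Sum>mu\<in>partitions_of d. of_int (?g mu) * sym_e_part d mu)"
    by (intro sum.cong refl) (simp add: sum_distrib_right)
  finally have eq: "(\<Sum>mu\<in>multisets_in {1..<p} n. of_int (m_weight n k mu) * (sym_e d (d - sum_mset mu) * sym_m d mu)) =
    (\<Sum>mu\<in>partitions_of d. of_int (?g mu) * sym_e_part d mu)" .
  have "of_int (int p) dvd sym_m d (one_p_partition p n k) -
      (\<Sum>mu\<in>multisets_in {1..<p} n. of_int (m_weight n k mu) * (sym_e d (d - sum_mset mu) * sym_m d mu))"
    unfolding d_def by (rule sym_m_one_p_congruence[OF p order_refl])
  also have "sym_m d (one_p_partition p n k) = (\<Sum>mu\<in>partitions_of d. of_int (alpha p n k mu) * sym_e_part d mu)"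
    using sym_m_eq[OF is_partition_one_p[OF p0]] by (simp add: alpha_eq[OF p0] sum_mset_one_p d_def)
  finally have "of_int (int p) dvd (\<Sum>mu\<in>partitions_of d. of_int (alpha p n k mu - ?g mu) * sym_e_part d mu)"
    unfolding eq sum_subtractf[symmetric] left_diff_distrib[symmetric] of_int_diff[symmetric] .
  from sym_e_part_independent[OF finite_partitions_of partitions_of_parts[OF _ order_refl] this mu[folded d_def]]
  show ?thesis by (simp only: d_def)
qed

section \<open>The polynomials \<open>mbar\<close> modulo p\<close>

lemma mbar_raw_congruence:
  assumes p: "prime p" and k: "n * (p - 2) \<le> k"
  shows "of_int (int p) dvd mbar_raw p n k - exy_comb (p * n + k) (h_coeff p n k)"
proof -
  define d where "d = p * n + k"
  let ?L = "\<lambda>mu. ex_part (mu - {#largest_part mu#}) * ey (largest_part mu)"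
  let ?g = "\<lambda>mu. \<Sum>lam\<in>{lam \<in> partitions_upto d. complete_to d lam = mu}. h_coeff p n k lam"
  have p2: "p \<ge> 2" using p by (rule prime_ge_2_nat)
  have L: "?L (complete_to d lam) = ex_part lam * ey (d - sum_mset lam)"
    if "h_coeff p n k lam \<noteq> 0" for lam
  proof -
    have le: "sum_mset lam \<le> (p - 1) * n" using h_coeff_support[OF that] by simp
    \<comment> \<open>The origin of the threshold n(p - 2): it makes d at least 2(p - 1)n. As |lam|
      is at most (p - 1)n, the complementary part d - |lam| is then no smaller than |lam|, hence
      than any part of \<open>lam\<close>.\<close>
    have "2 * ((p - 1) * n) = p * n + n * (p - 2)"
      using p2 by (auto simp: algebra_simps dest!: le_Suc_ex)
    then have d2: "sum_mset lam + (p - 1) * n \<le> d" using le k unfolding d_def by linarith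
    show ?thesis
    proof (cases "sum_mset lam = d")
      \<comment> \<open>This happens only for the empty partition in degree 0, where
        \<open>complete_to\<close> adds no part and both sides are 1.\<close>
      case True
      then have "(p - 1) * n = 0" using d2 by linarith
      then have "sum_mset lam = 0" using le by linarith
      moreover have "size lam \<le> sum_mset lam" if "0 \<notin># lam" for lam
        using that by (induction lam) auto
      ultimately have "lam = {#}"
        using h_coeff_support(1)[OF that] unfolding is_partition_def by (metis le_zero_eq size_eq_0_iff_empty)
      then show ?thesis using True by (simp add: complete_to_def largest_part_def)
    next
      case False
      have parts: "r \<le> d - sum_mset lam" if "r \<in># lam" for r
      proof -
        have "r \<le> sum_mset lam" using that by (auto dest: multi_member_split)
        then show ?thesis using le d2 by linarith
      qed
      then have "largest_part (add_mset (d - sum_mset lam) lam) = d - sum_mset lam"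
        unfolding largest_part_def by (auto intro!: Max_eqI)
      then show ?thesis using False by (simp add: complete_to_def)
    qed
  qed
  have "mbar_raw p n k - exy_comb d (h_coeff p n k) =
      (\<Sum>mu\<in>partitions_of d. of_int (alpha p n k mu - ?g mu) * ?L mu)"
  proof -
    have "exy_comb d (h_coeff p n k) =
        (\<Sum>lam\<in>partitions_upto d. of_int (h_coeff p n k lam) * ?L (complete_to d lam))"
      unfolding exy_comb_def
    proof (intro sum.cong refl)
      fix lam
      show "of_int (h_coeff p n k lam) * ex_part lam * ey (d - sum_mset lam) =
          of_int (h_coeff p n k lam) * ?L (complete_to d lam)"
      proof (cases "h_coeff p n k lam = 0")
        case False
        show ?thesis by (simp only: L[OF False] mult.assoc)
      qed simp
    qed
    also have "\<dots> = (\<Sum>mu\<in>partitions_of d. \<Sum>lam\<in>{lam \<in> partitions_upto d. complete_to d lam = mu}.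
        of_int (h_coeff p n k lam) * ?L (complete_to d lam))"
      by (rule sum.group[symmetric]) (use finite_partitions_upto finite_partitions_of complete_to_in in blast)+
    also have "\<dots> = (\<Sum>mu\<in>partitions_of d. of_int (?g mu) * ?L mu)"
      by (intro sum.cong refl) (simp add: sum_distrib_right)
    finally show ?thesis
      unfolding mbar_raw_def d_def[symmetric]
      by (simp only: sum_subtractf[symmetric] left_diff_distrib of_int_diff mult.assoc)
  qed
  also have "of_int (int p) dvd \<dots>"
    using alpha_congruence[OF p] unfolding d_def
    by (intro dvd_sum dvd_mult2 of_int_dvd_of_int_frag[THEN iffD2]) blast
  finally show ?thesis by (simp only: d_def)
qed

text \<open>Regrouping by \<open>mu\<close> gives a form on which \<open>H1_perp\<close> acts by
  deleting a part 1.\<close>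

lemma exy_comb_h_coeff:
  assumes "(p - 1) * n \<le> d"
  shows "exy_comb d (h_coeff p n k) =
    (\<Sum>mu\<in>multisets_in {1..<p} n. of_int (m_weight n k mu) * (m_ex mu * ey (d - sum_mset mu)))"
proof -
  have "(\<Sum>mu\<in>multisets_in {1..<p} n. of_int (m_weight n k mu) * (m_ex mu * ey (d - sum_mset mu))) =
      (\<Sum>mu\<in>multisets_in {1..<p} n. of_int (m_weight n k mu) *
      (\<Sum>lam\<in>partitions_of (sum_mset mu). of_int (m_to_e mu lam) * (ex_part lam * ey (d - sum_mset lam))))"
    by (intro sum.cong refl arg_cong2[where f = "(*)"])
      (simp add: m_ex_def sum_distrib_right mult.assoc partitions_of_def)
  also have "\<dots> = exy_comb d (h_coeff p n k)"
    unfolding exy_comb_def mult.assoc by (rule sum_m_weight_eq_sum_h_coeff[OF assms])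
  finally show ?thesis by simp
qed

text \<open>An extra part 1 costs a factor -t. The sum is therefore the weight for (1 - t) (1 -
  t)^(-k), which is Pascal's rule for \<open>neg_binom\<close>.\<close>

lemma m_weight_add_one:
  assumes "k \<ge> 1" "size mu \<le> n"
  shows "m_weight n k mu + m_weight n k (add_mset 1 mu) = m_weight n (k - 1) mu"
proof -
  obtain k' where k: "k = Suc k'" using assms by (cases k) auto
  show ?thesis
  proof (cases "size mu = n")
    case True
    then show ?thesis by (simp add: m_weight_def)
  next
    case False
    then obtain m where m: "n - size mu = Suc m" using assms(2) by (cases "n - size mu") auto
    then have "n - Suc (size mu) = m" by simp
    then show ?thesis using assms False m
      by (simp add: m_weight_def k neg_binom_Suc_Suc algebra_simps)
  qed
qed

lemma H1_perp_exy_comb_h_coeff: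
  assumes p: "p \<ge> 2" and k: "k \<ge> 1"
  shows "H1_perp (exy_comb (p * n + k) (h_coeff p n k)) = exy_comb (p * n + k - 1) (h_coeff p n (k - 1))"
proof -
  define d where "d = p * n + k"
  let ?T = "multisets_in {1..<p} n"
  let ?w = "\<lambda>mu. of_int (m_weight n k mu) :: epoly"
  have fin: "finite ?T" by (rule finite_multisets_in) simp
  \<comment> \<open>Because k is positive, d exceeds every |mu| that occurs. So the factor in y
    never has index 0, and \<open>H1_perp\<close> always lowers it.\<close>
  have d: "(p - 1) * n \<le> d - 1" "d \<ge> 1"
    using k by (auto simp: d_def algebra_simps intro: trans_le_add1)
  have ey: "H1_perp (ey (d - sum_mset mu)) = ey (d - 1 - sum_mset mu)" if "mu \<in> ?T" for mu
  proof -
    have "sum_mset mu < d" using sum_mset_multisets_in(2)[OF that] d by linarith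
    then show ?thesis using H1_perp_props(3)[of "d - sum_mset mu"] by simp
  qed
  have "H1_perp (exy_comb d (h_coeff p n k)) =
      (\<Sum>mu\<in>?T. ?w mu * (H1_perp (m_ex mu) * ey (d - sum_mset mu))) +
      (\<Sum>mu\<in>?T. ?w mu * (m_ex mu * ey (d - 1 - sum_mset mu)))"
  proof -
    have "exy_comb d (h_coeff p n k) = (\<Sum>mu\<in>?T. ?w mu * (m_ex mu * ey (d - sum_mset mu)))"
      by (rule exy_comb_h_coeff) (use d in linarith)
    then show ?thesis
      by (simp only: H1_perp_sum H1_perp_of_int_mult)
        (simp add: H1_perp_mult[of "m_ex _"] ey distrib_left sum.distrib)
  qed
  also have "(\<Sum>mu\<in>?T. ?w mu * (H1_perp (m_ex mu) * ey (d - sum_mset mu))) =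
      (\<Sum>mu\<in>{mu\<in>?T. 1 \<in># mu}. ?w mu * (m_ex (mu - {#1#}) * ey (d - sum_mset mu)))"
    by (rule sum.mono_neutral_cong_right)
      (use fin in \<open>auto simp: H1_perp_m_ex is_partition_multisets_in split: if_splits\<close>)
  also have "\<dots> = (\<Sum>nu\<in>{nu\<in>?T. size nu < n}. ?w (add_mset 1 nu) * (m_ex nu * ey (d - 1 - sum_mset nu)))"
  proof -
    have "{mu\<in>?T. 1 \<in># mu} = add_mset 1 ` {nu\<in>?T. size nu < n}" (is "?A = ?B")
    proof (intro equalityI subsetI)
      fix mu assume mu: "mu \<in> ?A"
      then obtain nu where "mu = add_mset 1 nu" by (auto dest: multi_member_split)
      with mu show "mu \<in> ?B" by (auto simp: multisets_in_def)
    qed (use p in \<open>auto simp: multisets_in_def subset_eq\<close>)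
    moreover have "inj_on (add_mset 1) {nu\<in>?T. size nu < n}" by (simp add: inj_on_def)
    ultimately show ?thesis by (simp add: sum.reindex del: One_nat_def)
  qed
  \<comment> \<open>The \<open>nu\<close> with n parts may be restored: with one more part,
    \<open>m_weight\<close> is zero.\<close>
  also have "\<dots> = (\<Sum>nu\<in>?T. ?w (add_mset 1 nu) * (m_ex nu * ey (d - 1 - sum_mset nu)))"
    by (rule sum.mono_neutral_left) (use fin in \<open>auto simp: multisets_in_def m_weight_def\<close>)
  also have "\<dots> + (\<Sum>mu\<in>?T. ?w mu * (m_ex mu * ey (d - 1 - sum_mset mu))) =
      (\<Sum>mu\<in>?T. of_int (m_weight n k mu + m_weight n k (add_mset 1 mu)) * (m_ex mu * ey (d - 1 - sum_mset mu)))"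
    by (simp add: sum.distrib[symmetric] algebra_simps)
  also have "\<dots> = (\<Sum>mu\<in>?T. of_int (m_weight n (k - 1) mu) * (m_ex mu * ey (d - 1 - sum_mset mu)))"
    by (intro sum.cong refl arg_cong2[where f = "(*)"] arg_cong[where f = of_int] m_weight_add_one k)
      (simp add: multisets_in_def)
  also have "\<dots> = exy_comb (d - 1) (h_coeff p n (k - 1))"
    by (rule exy_comb_h_coeff[OF d(1), symmetric])
  finally show ?thesis by (simp only: d_def)
qed

lemma mbar_congruence:
  assumes p: "prime p"
  shows "of_int (int p) dvd mbar p n k - exy_comb (p * n + k) (h_coeff p n k)"
proof (cases "n * (p - 2) \<le> k")
  case True
  then show ?thesis using mbar_raw_congruence[OF p] by (simp add: mbar_def)
next
  case False
  have p2: "p \<ge> 2" using p by (rule prime_ge_2_nat)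
  let ?k = "n * (p - 2)"
  have "of_int (int p) dvd (H1_perp ^^ j) (mbar_raw p n ?k) - exy_comb (p * n + (?k - j)) (h_coeff p n (?k - j))"
    if "j \<le> ?k" for j
    using that
  proof (induction j)
    case 0
    then show ?case using mbar_raw_congruence[OF p order_refl] by simp
  next
    case (Suc j)
    let ?f = "(H1_perp ^^ j) (mbar_raw p n ?k)" and ?g = "exy_comb (p * n + (?k - j)) (h_coeff p n (?k - j))"
    have "of_int (int p) dvd ?f - ?g" using Suc.prems by (intro Suc.IH) linarith
    \<comment> \<open>\<open>H1_perp\<close> is linear over the integers, so it preserves
      divisibility by p.\<close>
    then obtain q where "?f - ?g = of_int (int p) * q" by (rule dvdE)
    from arg_cong[OF this, of H1_perp] have "H1_perp ?f - H1_perp ?g = of_int (int p) * H1_perp q"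
      unfolding H1_perp_diff H1_perp_of_int_mult .
    moreover have "H1_perp ?g = exy_comb (p * n + (?k - Suc j)) (h_coeff p n (?k - Suc j))"
    proof -
      have "p * n + (?k - j) - 1 = p * n + (?k - Suc j)" "?k - j - 1 = ?k - Suc j"
        using Suc.prems by linarith+
      moreover have "?k - j \<ge> 1" using Suc.prems by linarith
      ultimately show ?thesis
        using H1_perp_exy_comb_h_coeff[OF p2, of "?k - j" n] by (simp only:)
    qed
    ultimately show ?case by (simp only: funpow.simps comp_apply dvd_triv_left)
  qed
  from this[of "?k - k"] show ?thesis using False by (simp add: mbar_def)
qed

section \<open>The coefficients \<open>beta\<close> modulo p and the range of summation\<close>

lemma beta_congruence:
  assumes p: "prime p"
  shows "[beta p n k lam = h_coeff p n k lam] (mod int p)"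
proof (cases "lam \<in> partitions_upto (p * n + k)")
  case True
  have "of_int (int p) dvd exy_comb (p * n + k) (beta p n k) - exy_comb (p * n + k) (h_coeff p n k)"
    using mbar_congruence[OF p] unfolding beta_spec(1)[OF prime_ge_2_nat[OF p]] .
  from exy_comb_dvd[OF this True] show ?thesis by (simp add: cong_iff_dvd_diff)
next
  case False
  have "(p - 1) * n \<le> p * n + k" by (simp add: trans_le_add1)
  then have "h_coeff p n k lam = 0" using False h_coeff_support[of p n k lam] by fastforce
  then show ?thesis using beta_spec(2)[OF prime_ge_2_nat[OF p] False] by simp
qed

text \<open>Each part of \<open>mu\<close> carries one t, so grouping by i = \<open>size mu\<close>
  sorts the second product by powers of t. For k = 0 the weight keeps exactly the \<open>mu\<close>
  with i parts, so \<open>h_coeff p i 0\<close> is the contribution of t^i.\<close>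

lemma h_coeff_expand:
  "h_coeff p n k lam = (\<Sum>i\<le>n. h_coeff p i 0 lam * neg_binom k (n - i))"
proof -
  let ?T = "multisets_in {1..<p}"
  have fin: "finite (?T n)" for n by (rule finite_multisets_in) simp
  let ?g = "\<lambda>mu. (-1) ^ sum_mset mu * m_to_e mu lam"
  have h0: "h_coeff p i 0 lam = (\<Sum>mu\<in>{mu\<in>?T n. size mu = i}. ?g mu)" if "i \<le> n" for i
    unfolding h_coeff_def
    by (rule sum.mono_neutral_cong_right)
      (use fin that in \<open>auto simp: m_weight_def neg_binom_0_left multisets_in_def\<close>)
  have "h_coeff p n k lam = (\<Sum>i\<le>n. \<Sum>mu\<in>{mu\<in>?T n. size mu = i}. m_weight n k mu * m_to_e mu lam)"
    unfolding h_coeff_def by (rule sum.group[symmetric, OF fin]) (auto simp: multisets_in_def)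
  also have "\<dots> = (\<Sum>i\<le>n. h_coeff p i 0 lam * neg_binom k (n - i))"
  proof (intro sum.cong refl)
    fix i assume "i \<in> {..n}"
    then show "(\<Sum>mu\<in>{mu\<in>?T n. size mu = i}. m_weight n k mu * m_to_e mu lam) =
        h_coeff p i 0 lam * neg_binom k (n - i)"
      by (simp add: h0 sum_distrib_right) (auto simp: m_weight_def mult_ac intro!: sum.cong)
  qed
  finally show ?thesis .
qed

text \<open>A nonzero value comes from some \<open>mu\<close> with exactly i parts, all below p. Its
  weight |mu| = |lam| is at most (p - 1) i, which gives the lower bound; \<open>m_to_e_size\<close>
  gives the upper one.\<close>

lemma h_coeff_0_range:
  assumes p: "p \<ge> 2" and nz: "h_coeff p i 0 lam \<noteq> 0"
  shows "nat \<lceil>real (sum_mset lam) / real (p - 1)\<rceil> \<le> i" "i \<le> largest_part lam"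
proof -
  have "sum_mset lam \<le> (p - 1) * i" using h_coeff_support(2)[OF nz] .
  then have "real (sum_mset lam) \<le> real (p - 1) * real i" by (metis of_nat_le_iff of_nat_mult)
  then have "real (sum_mset lam) / real (p - 1) \<le> real i" using p by (simp add: divide_le_eq mult.commute)
  then show "nat \<lceil>real (sum_mset lam) / real (p - 1)\<rceil> \<le> i" by (simp add: nat_le_iff ceiling_le_iff)
  obtain mu where "mu \<in> multisets_in {1..<p} i" "m_weight i 0 mu * m_to_e mu lam \<noteq> 0"
    using nz unfolding h_coeff_def by (rule sum.not_neutral_contains_not_neutral)
  then have mu: "mu \<in> multisets_in {1..<p} i" "m_weight i 0 mu \<noteq> 0" "m_to_e mu lam \<noteq> 0" by auto
  then have "size mu = i" by (auto simp: m_weight_def neg_binom_0_left split: if_splits)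
  then show "i \<le> largest_part lam"
    using m_to_e_size[OF is_partition_multisets_in[OF mu(1)] mu(3)] by simp
qed

theorem corollary6:
  fixes p n k n0 n1 :: nat and lam :: partition
  assumes "prime p"
    and "is_partition lam"
    and "size lam \<le> p - 1"
    and "n0 = nat \<lceil>real (sum_mset lam) / real (p - 1)\<rceil>"
    and "n1 = largest_part lam"
  shows "[beta p n k lam =
           (\<Sum>i = n0..n1. beta p i 0 lam * binom (int n + int k - int i - 1) (int n - int i))]
         (mod int p)"
proof -
  let ?b = "\<lambda>i. binom (int n + int k - int i - 1) (int n - int i)"
  have p2: "p \<ge> 2" using assms(1) by (rule prime_ge_2_nat)
  have b: "?b i = (if i \<le> n then neg_binom k (n - i) else 0)" for i
    by (auto simp: neg_binom_def binom_def of_nat_diff algebra_simps)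
  have range: "i \<in> {n0..n1}" if "h_coeff p i 0 lam \<noteq> 0" for i
    using h_coeff_0_range[OF p2 that] assms(4,5) by simp
  have "h_coeff p n k lam = (\<Sum>i\<le>n. h_coeff p i 0 lam * ?b i)"
    unfolding h_coeff_expand[of p n k] by (intro sum.cong refl) (simp add: b)
  also have "\<dots> = (\<Sum>i\<in>{..n} \<inter> {n0..n1}. h_coeff p i 0 lam * ?b i)"
  proof (rule sum.mono_neutral_right)
    show "\<forall>i\<in>{..n} - {..n} \<inter> {n0..n1}. h_coeff p i 0 lam * ?b i = 0"
      using range by (metis DiffE IntI mult_zero_left)
  qed auto
  \<comment> \<open>Indices i > n may be added, since a negative lower argument makes
    \<open>binom\<close> zero.\<close>
  also have "\<dots> = (\<Sum>i = n0..n1. h_coeff p i 0 lam * ?b i)"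
    by (rule sum.mono_neutral_left) (auto simp: b)
  finally have h: "h_coeff p n k lam = (\<Sum>i = n0..n1. h_coeff p i 0 lam * ?b i)" .
  have "[beta p n k lam = h_coeff p n k lam] (mod int p)"
    by (rule beta_congruence[OF assms(1)])
  also have "[h_coeff p n k lam = (\<Sum>i = n0..n1. beta p i 0 lam * ?b i)] (mod int p)"
    unfolding h by (intro cong_sum cong_mult cong_refl cong_sym[OF beta_congruence[OF assms(1)]])
  finally show ?thesis .
qed

end
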